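(* There exist an integer $n\ge 2$ and a bounded quadrature domain $\Omega\subset\mathbb{C}^n$ whose Bergman kernel is non-algebraic.
   Context: For a domain $\Omega\subset\mathbb{C}^n$, $H^2(\Omega)$ is the Bergman space of holomorphic functions on $\Omega$ square-integrable with respect to Lebesgue measure, and $K(z,w)$ is its Bergman kernel: holomorphic in $z$, antiholomorphic in $w$, with $\int_\Omega f(w)K(z,w)\,dV(w)=f(z)$ for all $f\in H^2(\Omega)$. A domain $\Omega$ is a quadrature domain (for $H^2$ functions) if there exist finitely many points $z_i\in\Omega$ and constants $c_{i\alpha}$ with $\int_\Omega f\,dV=\sum_{i,\alpha}c_{i\alpha}\frac{\partial^\alpha f}{\partial z^\alpha}(z_i)$ for all $f\in H^2(\Omega)$. The Bergman kernel is algebraic if it is an algebraic function of $(z,\bar w)$, i.e. there is a nonzero polynomial $P$ in $2n+1$ variables over $\mathbb{C}$ with $P(z,\bar w,K(z,w))=0$ for all $z,w\in\Omega$; otherwise it is non-algebraic. *)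

theory Defs
  imports "HOL-Analysis.Analysis" "HOL-Library.Poly_Mapping"
begin

text \<open>
  The dimension is quantified inside the statement, so it cannot be a type. A point of
  \<open>\<complex>\<^sup>n\<close> is a function \<open>nat \<Rightarrow> complex\<close> that equals \<open>undefined\<close> outside \<open>{..<n}\<close>; these
  functions are exactly the underlying space of the product measure \<open>lebesgue_Cn n\<close>.
  The type class topology on \<open>nat \<Rightarrow> complex\<close> is the product topology, so on the subset
  \<open>Cn n\<close> it induces the usual topology of \<open>\<complex>\<^sup>n\<close>.
\<close>

definition Cn :: "nat \<Rightarrow> (nat \<Rightarrow> complex) set" where
  "Cn n = ({..<n} \<rightarrow>\<^sub>E UNIV)"

text \<open>
  Borel sets suffice below: everything is integrated over open sets, and the functions
  integrated are continuous there.
\<close>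

definition lebesgue_Cn :: "nat \<Rightarrow> (nat \<Rightarrow> complex) measure" where
  "lebesgue_Cn n = Pi\<^sub>M {..<n} (\<lambda>_. lborel)"

definition norm_Cn :: "nat \<Rightarrow> (nat \<Rightarrow> complex) \<Rightarrow> real" where
  "norm_Cn n z = L2_set (\<lambda>i. cmod (z i)) {..<n}"

definition domain_Cn :: "nat \<Rightarrow> (nat \<Rightarrow> complex) set \<Rightarrow> bool" where
  "domain_Cn n \<Omega> \<longleftrightarrow> openin (top_of_set (Cn n)) \<Omega> \<and> connected \<Omega> \<and> \<Omega> \<noteq> {}"

text \<open>
  The library's \<^const>\<open>bounded\<close> is of no use here: the metric that the library puts on
  \<open>nat \<Rightarrow> complex\<close> is itself bounded.
\<close>

definition bounded_Cn :: "nat \<Rightarrow> (nat \<Rightarrow> complex) set \<Rightarrow> bool" where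
  "bounded_Cn n \<Omega> \<longleftrightarrow> (\<exists>B. \<forall>z\<in>\<Omega>. norm_Cn n z \<le> B)"

text \<open>
  Complex differentiability at every point: there is a complex linear map
  \<open>h \<mapsto> (\<Sum>i<n. a i * h i)\<close> approximating the increment of \<open>f\<close> up to \<open>o(\<parallel>h\<parallel>)\<close>.
\<close>

definition holomorphic_Cn ::
    "nat \<Rightarrow> (nat \<Rightarrow> complex) set \<Rightarrow> ((nat \<Rightarrow> complex) \<Rightarrow> complex) \<Rightarrow> bool" where
  "holomorphic_Cn n \<Omega> f \<longleftrightarrow>
     (\<forall>z\<in>\<Omega>. \<exists>a :: nat \<Rightarrow> complex.
        ((\<lambda>w. (f w - f z - (\<Sum>i<n. a i * (w i - z i)))
               / of_real (norm_Cn n (\<lambda>i. w i - z i))) \<longlongrightarrow> 0) (at z within \<Omega>))"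

definition bergman_space ::
    "nat \<Rightarrow> (nat \<Rightarrow> complex) set \<Rightarrow> ((nat \<Rightarrow> complex) \<Rightarrow> complex) set" where
  "bergman_space n \<Omega> =
     {f. holomorphic_Cn n \<Omega> f \<and> set_integrable (lebesgue_Cn n) \<Omega> (\<lambda>z. (cmod (f z))\<^sup>2)}"

text \<open>
  Membership of \<open>\<lambda>w. cnj (K z w)\<close> in the Bergman space says that \<open>K\<close> is antiholomorphic
  and square-integrable in its second argument; the latter makes the integrals in the
  reproducing property exist and determines \<open>K\<close> on \<open>\<Omega> \<times> \<Omega>\<close>, see
  \<open>is_bergman_kernel_unique\<close>.
\<close>

definition is_bergman_kernel ::
    "nat \<Rightarrow> (nat \<Rightarrow> complex) set \<Rightarrow> ((nat \<Rightarrow> complex) \<Rightarrow> (nat \<Rightarrow> complex) \<Rightarrow> complex) \<Rightarrow> bool"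
  where
  "is_bergman_kernel n \<Omega> K \<longleftrightarrow>
     (\<forall>w\<in>\<Omega>. holomorphic_Cn n \<Omega> (\<lambda>z. K z w)) \<and>
     (\<forall>z\<in>\<Omega>. (\<lambda>w. cnj (K z w)) \<in> bergman_space n \<Omega>) \<and>
     (\<forall>f\<in>bergman_space n \<Omega>. \<forall>z\<in>\<Omega>.
        (LINT w:\<Omega>|lebesgue_Cn n. f w * K z w) = f z)"

lemma is_bergman_kernel_cnj:
  assumes "is_bergman_kernel n \<Omega> K" "is_bergman_kernel n \<Omega> K'" "z \<in> \<Omega>" "u \<in> \<Omega>"
  shows "K' z u = cnj (K u z)"
proof -
  have "cnj (K u z) = (LINT w:\<Omega>|lebesgue_Cn n. cnj (K u w) * K' z w)"
    using assms unfolding is_bergman_kernel_def by simp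
  also have "\<dots> = cnj (LINT w:\<Omega>|lebesgue_Cn n. cnj (K' z w) * K u w)"
    unfolding set_lebesgue_integral_def Bochner_Integration.integral_cnj[symmetric]
    by (simp add: mult.commute del: Bochner_Integration.integral_cnj)
  also have "\<dots> = K' z u"
    using assms unfolding is_bergman_kernel_def by simp
  finally show ?thesis ..
qed

lemma is_bergman_kernel_unique:
  assumes "is_bergman_kernel n \<Omega> K" "is_bergman_kernel n \<Omega> K'" "z \<in> \<Omega>" "u \<in> \<Omega>"
  shows "K' z u = K z u"
  using is_bergman_kernel_cnj[OF assms] is_bergman_kernel_cnj[OF assms(1,1,3,4)] by simp

definition partial_deriv ::
    "nat \<Rightarrow> ((nat \<Rightarrow> complex) \<Rightarrow> complex) \<Rightarrow> (nat \<Rightarrow> complex) \<Rightarrow> complex" where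
  "partial_deriv i f z = deriv (\<lambda>t. f (z(i := t))) (z i)"

text \<open>
  \<open>multi_deriv n \<alpha> f\<close> is \<open>\<partial>\<^sup>\<alpha>f/\<partial>z\<^sup>\<alpha>\<close> with \<open>\<alpha> = (\<alpha> 0, \<dots>, \<alpha> (n-1))\<close>. The partial derivatives
  of a holomorphic function commute, so the order in which they are taken is immaterial.
\<close>

primrec multi_deriv ::
    "nat \<Rightarrow> (nat \<Rightarrow> nat) \<Rightarrow> ((nat \<Rightarrow> complex) \<Rightarrow> complex) \<Rightarrow> (nat \<Rightarrow> complex) \<Rightarrow> complex" where
  "multi_deriv 0 \<alpha> f = f"
| "multi_deriv (Suc n) \<alpha> f = (partial_deriv n ^^ \<alpha> n) (multi_deriv n \<alpha> f)"

text \<open>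
  Integrability of \<open>f\<close> is stated explicitly because the library's integral is \<open>0\<close> for
  non-integrable functions; it is automatic when \<open>\<Omega>\<close> is bounded.
\<close>

definition quadrature_domain :: "nat \<Rightarrow> (nat \<Rightarrow> complex) set \<Rightarrow> bool" where
  "quadrature_domain n \<Omega> \<longleftrightarrow> domain_Cn n \<Omega> \<and>
     (\<exists>Z A (c :: (nat \<Rightarrow> complex) \<Rightarrow> (nat \<Rightarrow> nat) \<Rightarrow> complex).
        finite Z \<and> Z \<subseteq> \<Omega> \<and> finite A \<and> A \<subseteq> ({..<n} \<rightarrow>\<^sub>E UNIV) \<and>
        (\<forall>f\<in>bergman_space n \<Omega>.
           set_integrable (lebesgue_Cn n) \<Omega> f \<and>
           (LINT z:\<Omega>|lebesgue_Cn n. f z) = (\<Sum>z\<in>Z. \<Sum>\<alpha>\<in>A. c z \<alpha> * multi_deriv n \<alpha> f z)))"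

text \<open>
  Polynomials with variables indexed by \<open>nat\<close>: finitely supported maps from monomials
  (finitely supported exponent functions) to coefficients.
\<close>

type_synonym complex_mpoly = "(nat \<Rightarrow>\<^sub>0 nat) \<Rightarrow>\<^sub>0 complex"

definition in_variables :: "nat \<Rightarrow> complex_mpoly \<Rightarrow> bool" where
  "in_variables N P \<longleftrightarrow> (\<forall>m\<in>Poly_Mapping.keys P. Poly_Mapping.keys m \<subseteq> {..<N})"

definition eval_mpoly :: "complex_mpoly \<Rightarrow> (nat \<Rightarrow> complex) \<Rightarrow> complex" where
  "eval_mpoly P x =
     (\<Sum>m\<in>Poly_Mapping.keys P.
        Poly_Mapping.lookup P m * (\<Prod>i\<in>Poly_Mapping.keys m. x i ^ Poly_Mapping.lookup m i))"

text \<open>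
  The variables \<open>0, \<dots>, n - 1\<close> of \<open>P\<close> stand for \<open>z\<close>, the variables \<open>n, \<dots>, 2n - 1\<close> for
  the conjugate of \<open>w\<close>, and the variable \<open>2n\<close> for \<open>K z w\<close>.
\<close>

definition algebraic_kernel ::
    "nat \<Rightarrow> (nat \<Rightarrow> complex) set \<Rightarrow> ((nat \<Rightarrow> complex) \<Rightarrow> (nat \<Rightarrow> complex) \<Rightarrow> complex) \<Rightarrow> bool"
  where
  "algebraic_kernel n \<Omega> K \<longleftrightarrow>
     (\<exists>P. P \<noteq> 0 \<and> in_variables (2 * n + 1) P \<and>
        (\<forall>z\<in>\<Omega>. \<forall>w\<in>\<Omega>.
           eval_mpoly P (\<lambda>i. if i < n then z i
                             else if i < 2 * n then cnj (w (i - n))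
                             else K z w) = 0))"

end

theory Submission
  imports Defs "HOL-Complex_Analysis.Complex_Analysis" "HOL-Real_Asymp.Real_Asymp"
begin

text \<open>
  For an irrational \<open>a > 0\<close> take the Hartogs domain \<open>\<bar>x\<bar> < 1\<close>, \<open>\<bar>y\<bar>\<^sup>2 < (1 - \<bar>x\<bar>\<^sup>2) powr a\<close> in
  \<open>\<complex>\<^sup>2\<close>. Expanding in powers of \<open>y\<close> reduces its Bergman kernel to the weighted Bergman
  kernels \<open>(1 - s) powr (- \<alpha> - 2)\<close> of the disc with weight \<open>(1 - \<bar>x\<bar>\<^sup>2) powr \<alpha>\<close>,
  \<open>\<alpha> = a (k + 1)\<close>, and the resulting series has a closed form in \<open>s = z\<^sub>0 cnj w\<^sub>0\<close> and
  \<open>t = z\<^sub>1 cnj w\<^sub>1\<close>. The kernel is constant when one argument is the origin, so the reproducing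
  property there is a one-point quadrature formula. As \<open>t \<rightarrow> 0\<close> the kernel tends to a multiple of
  \<open>(1 - s) powr (- a - 2)\<close>; since \<open>a\<close> is irrational, along a suitable curve distinct monomials in
  the coordinates and the kernel grow at distinct rates, so no polynomial relation is possible.
\<close>

section \<open>Rotations and radial integrals in the complex plane\<close>

text \<open>The choice of \<open>a\<close> is what decides the matter: for rational \<open>a\<close>
  the closed form is an algebraic function of s and t. Reproduction is verified directly. The kernel
  series is integrated term by term against an arbitrary function, and rotation averages combined
  with Cauchy's formula pick out one Taylor coefficient at a time. For a fixed first point the
  kernel is bounded in the second, so the argument runs in L^1, which contains the Bergman space
  because the domain has finite volume. Two obstacles shape the algebraic part. The kernel sees only
  the two products s and t, but a relation may involve all four coordinates independently, so four
  separate rates have to be arranged. And t cannot simply be set to 0, since the polynomial may be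
  divisible by the variables behind it; both factors of t are therefore sent to 0 at rates that
  enter the comparison of monomials.\<close>

text \<open>Lebesgue measure on the plane is identified by its values on boxes, which factor into
  side lengths. The iterated form is what makes shears accessible.\<close>

lemma nn_integral_lborel_complex:
  assumes [measurable]: "f \<in> borel_measurable borel"
  shows "(\<integral>\<^sup>+z. f z \<partial>lborel) = (\<integral>\<^sup>+x. \<integral>\<^sup>+y. f (Complex x y) \<partial>lborel \<partial>lborel)"
proof -
  have [measurable]: "(\<lambda>(x, y). Complex x y) \<in> borel \<Otimes>\<^sub>M borel \<rightarrow>\<^sub>M borel"
    unfolding Complex_eq by measurable
  have "lborel = distr (lborel \<Otimes>\<^sub>M lborel) borel (\<lambda>(x, y). Complex x y)"
  proof (rule lborel_eqI)
    fix l u :: complex assume le: "\<And>b. b \<in> Basis \<Longrightarrow> l \<bullet> b \<le> u \<bullet> b"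
    have "(\<lambda>(x, y). Complex x y) -` box l u = {Re l<..<Re u} \<times> {Im l<..<Im u}"
      by (auto simp: in_box_complex_iff)
    then show "emeasure (distr (lborel \<Otimes>\<^sub>M lborel) borel (\<lambda>(x, y). Complex x y)) (box l u)
        = (\<Prod>b\<in>Basis. (u - l) \<bullet> b)"
      using le[of 1] le[of \<i>]
      by (subst emeasure_distr)
         (auto simp: space_pair_measure lborel.emeasure_pair_measure_Times Basis_complex_def
           ennreal_mult)
  qed simp
  then have "(\<integral>\<^sup>+z. f z \<partial>lborel) = (\<integral>\<^sup>+z. f z \<partial>distr (lborel \<Otimes>\<^sub>M lborel) borel (\<lambda>(x, y). Complex x y))"
    by simp
  also have "\<dots> = (\<integral>\<^sup>+x. \<integral>\<^sup>+y. f (Complex x y) \<partial>lborel \<partial>lborel)"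
    by (subst nn_integral_distr)
       (simp_all add: case_prod_beta' lborel.nn_integral_fst[symmetric])
  finally show ?thesis .
qed

lemma nn_integral_lborel_translate:
  fixes f :: "real \<Rightarrow> ennreal"
  assumes [measurable]: "f \<in> borel_measurable borel"
  shows "(\<integral>\<^sup>+x. f (x + c) \<partial>lborel) = (\<integral>\<^sup>+x. f x \<partial>lborel)"
  using nn_integral_real_affine[of f 1 c] by (simp add: add.commute)

lemma measurable_Complex [measurable]:
  assumes [measurable]: "f \<in> borel_measurable M" "g \<in> borel_measurable M"
  shows "(\<lambda>x. Complex (f x) (g x)) \<in> borel_measurable M"
  unfolding Complex_eq by measurable

text \<open>A shear translates every line parallel to one axis by an amount constant on that line,
  so translation invariance applies to the inner integral. The horizontal shear needs the order of
  integration exchanged first.\<close>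

lemma nn_integral_complex_shear:
  assumes [measurable]: "f \<in> borel_measurable borel"
  shows "(\<integral>\<^sup>+z. f (z + of_real (p * Im z)) \<partial>lborel) = (\<integral>\<^sup>+z. f z \<partial>lborel)"
    and "(\<integral>\<^sup>+z. f (z + \<i> * of_real (p * Re z)) \<partial>lborel) = (\<integral>\<^sup>+z. f z \<partial>lborel)"
proof -
  have sw: "(\<integral>\<^sup>+x. \<integral>\<^sup>+y. g (Complex x y) \<partial>lborel \<partial>lborel) = (\<integral>\<^sup>+y. \<integral>\<^sup>+x. g (Complex x y) \<partial>lborel \<partial>lborel)"
    if [measurable]: "g \<in> borel_measurable borel" for g :: "complex \<Rightarrow> ennreal"
    by (rule lborel_pair.Fubini'[symmetric]) measurable
  have e1: "Complex x y + of_real (p * y) = Complex (x + p * y) y"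
    and e2: "Complex x y + \<i> * of_real (p * x) = Complex x (y + p * x)" for x y
    by (simp_all add: complex_eq_iff)
  show "(\<integral>\<^sup>+z. f (z + of_real (p * Im z)) \<partial>lborel) = (\<integral>\<^sup>+z. f z \<partial>lborel)"
    apply (subst (1 2) nn_integral_lborel_complex, measurable)
    apply (subst (1 2) sw, measurable)
    using nn_integral_lborel_translate[where f="\<lambda>x. f (Complex x y)" and c="p * y" for y]
    by (simp del: of_real_mult add: e1)
  show "(\<integral>\<^sup>+z. f (z + \<i> * of_real (p * Re z)) \<partial>lborel) = (\<integral>\<^sup>+z. f z \<partial>lborel)"
    apply (subst (1 2) nn_integral_lborel_complex, measurable)
    using nn_integral_lborel_translate[where f="\<lambda>y. f (Complex x y)" and c="p * x" for x]
    by (simp del: of_real_mult add: e2)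
qed

text \<open>A rotation other than \<open>- 1\<close> is a product of three shears.\<close>
lemma nn_integral_complex_rotate:
  assumes [measurable]: "f \<in> borel_measurable borel" and c: "cmod c = 1"
  shows "(\<integral>\<^sup>+z. f (c * z) \<partial>lborel) = (\<integral>\<^sup>+z. f z \<partial>lborel)"
proof -
  have *: "(\<integral>\<^sup>+z. f (c * z) \<partial>lborel) = (\<integral>\<^sup>+z. f z \<partial>lborel)"
    if [measurable]: "f \<in> borel_measurable borel" and c: "cmod c = 1" and ne: "Re c \<noteq> -1"
    for f :: "complex \<Rightarrow> ennreal" and c
  proof -
    \<comment> \<open>For c = exp (i \<theta>) this is - tan (\<theta> / 2), the coefficient in the
      factorisation of a rotation into shears; it degenerates exactly at c = -1.\<close>
    define p where "p = - Im c / (1 + Re c)"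
    define A where "A z = z + of_real (p * Im z)" for z
    define B where "B z = z + \<i> * of_real (Im c * Re z)" for z
    have [measurable]: "A \<in> borel_measurable borel" "B \<in> borel_measurable borel"
      unfolding A_def B_def by measurable
    have cc: "(Re c)\<^sup>2 + (Im c)\<^sup>2 = 1" using c by (simp add: cmod_def)
    have k1: "1 + p * Im c = Re c"
    proof -
      have "(1 + Re c) * (1 + p * Im c) = 1 + Re c - (Im c)\<^sup>2"
        using ne by (simp add: p_def field_simps power2_eq_square)
      also have "\<dots> = (1 + Re c) * Re c" using cc by (simp add: algebra_simps power2_eq_square)
      finally show ?thesis using ne by (simp add: add_eq_0_iff2)
    qed
    have k2: "p + (1 + p * Im c) * p = - Im c"
    proof -
      have "p + (1 + p * Im c) * p = p * (1 + Re c)" unfolding k1 by (simp add: algebra_simps)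
      also have "\<dots> = - Im c" using ne by (simp add: p_def add_eq_0_iff2)
      finally show ?thesis .
    qed
    have k3: "Re z * (1 + p * Im c) + Im z * (p + (1 + p * Im c) * p) = Re c * Re z - Im c * Im z" for z
      by (subst k2, subst k1) (simp add: algebra_simps)
    have "c * z = A (B (A z))" for z
    proof (rule complex_eqI)
      have "Re (A (B (A z))) = Re z * (1 + p * Im c) + Im z * (p + (1 + p * Im c) * p)"
        by (simp add: A_def B_def algebra_simps)
      then show "Re (c * z) = Re (A (B (A z)))" unfolding k3 by simp
      have "Im (A (B (A z))) = Im c * Re z + (1 + p * Im c) * Im z"
        by (simp add: A_def B_def algebra_simps)
      then show "Im (c * z) = Im (A (B (A z)))" unfolding k1 by simp
    qed
    then have "(\<integral>\<^sup>+z. f (c * z) \<partial>lborel) = (\<integral>\<^sup>+z. f (A (B (A z))) \<partial>lborel)" by simp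
    also have "\<dots> = (\<integral>\<^sup>+z. f (A (B z)) \<partial>lborel)"
      using nn_integral_complex_shear(1)[of "\<lambda>z. f (A (B z))" p] by (simp add: A_def)
    also have "\<dots> = (\<integral>\<^sup>+z. f (A z) \<partial>lborel)"
      using nn_integral_complex_shear(2)[of "\<lambda>z. f (A z)" "Im c"] by (simp add: B_def)
    also have "\<dots> = (\<integral>\<^sup>+z. f z \<partial>lborel)"
      using nn_integral_complex_shear(1)[of f p] by (simp add: A_def)
    finally show ?thesis .
  qed
  show ?thesis
  proof (cases "Re c = -1")
    case True
    \<comment> \<open>The half turn is made of two quarter turns, whose real part 0 puts them in the
      case already settled.\<close>
    then have "c = \<i> * \<i>" using c by (auto simp: complex_eq_iff cmod_def)
    then show ?thesis using *[of "\<lambda>z. f (\<i> * z)" \<i>] *[of f \<i>] by (simp add: mult.assoc)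
  qed (use * c in auto)
qed

lemma lborel_distr_complex_rotate:
  assumes "cmod c = 1"
  shows "distr lborel borel ((*) c) = (lborel :: complex measure)"
proof (rule measure_eqI)
  fix A assume "A \<in> sets (distr lborel borel ((*) c))"
  then have [measurable]: "A \<in> sets borel" by simp
  have "emeasure (distr lborel borel ((*) c)) A = (\<integral>\<^sup>+z. indicator A (c * z) \<partial>lborel)"
    by (subst nn_integral_indicator[symmetric], simp, subst nn_integral_distr) auto
  also have "\<dots> = emeasure lborel A"
    using nn_integral_complex_rotate[of "indicator A" c] assms by simp
  finally show "emeasure (distr lborel borel ((*) c)) A = emeasure lborel A" .
qed simp

text \<open>The disc of squared radius x has area pi * x, so |z|^2 pushes Lebesgue measure forward
  to pi times Lebesgue measure on the half-line; with |z| in place of |z|^2 the density would not be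
  constant. The rays \<open>{..<x}\<close> suffice for the comparison, being an intersection-stable
  generator.\<close>

lemma nn_integral_complex_radial:
  assumes [measurable]: "h \<in> borel_measurable borel"
  shows "(\<integral>\<^sup>+z. h ((cmod z)\<^sup>2) \<partial>lborel) = ennreal pi * (\<integral>\<^sup>+x. h x * indicator {0..} x \<partial>lborel)"
proof -
  define N where "N = distr (lborel :: complex measure) borel (\<lambda>z. (cmod z)\<^sup>2)"
  define L where "L = density (lborel :: real measure) (\<lambda>x. ennreal pi * indicator {0..} x)"
  have eN: "emeasure N {..<x} = ennreal (pi * x)" if "x > 0" for x
  proof -
    have "(\<lambda>z::complex. (cmod z)\<^sup>2) -` {..<x} = ball 0 (sqrt x)"
      using that by (auto simp: real_less_rsqrt) (metis norm_ge_zero real_sqrt_less_iff real_sqrt_unique)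
    then have "emeasure N {..<x} = emeasure lborel (ball (0::complex) (sqrt x))"
      unfolding N_def by (subst emeasure_distr) auto
    also have "\<dots> = ennreal (pi * x)"
      using that by (subst emeasure_ball) (auto simp: unit_ball_vol_2)
    finally show ?thesis .
  qed
  have eN0: "emeasure N {..<x} = 0" if "x \<le> 0" for x
  proof -
    have "(\<lambda>z::complex. (cmod z)\<^sup>2) -` {..<x} = {}"
      using that by (auto simp: not_less) (metis not_le order_trans zero_le_power2)
    then show ?thesis unfolding N_def by (subst emeasure_distr) auto
  qed
  have eL: "emeasure L {..<x} = ennreal (pi * max 0 x)" for x
  proof -
    have "emeasure L {..<x} = (\<integral>\<^sup>+y. ennreal pi * indicator {0..<x} y \<partial>lborel)"
      unfolding L_def by (subst emeasure_density) (auto intro!: nn_integral_cong simp: indicator_def)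
    also have "\<dots> = ennreal (pi * max 0 x)"
      by (subst nn_integral_cmult_indicator) (auto simp: max_def ennreal_mult)
    finally show ?thesis .
  qed
  have NL: "N = L"
  proof (rule measure_eqI_generator_eq[where E="range lessThan" and \<Omega>=UNIV and A="\<lambda>n::nat. {..<real n}"])
    show "Int_stable (range lessThan :: real set set)"
    proof -
      have "{..<a} \<inter> {..<b} = {..<min a b}" for a b :: real by auto
      then show ?thesis by (auto simp: Int_stable_def)
    qed
    show "sets N = sigma_sets UNIV (range lessThan)" "sets L = sigma_sets UNIV (range lessThan)"
      unfolding N_def L_def by (auto simp: borel_Iio)
    show "(\<Union>i::nat. {..<real i}) = UNIV" by (auto intro: reals_Archimedean2)
    show "emeasure N {..<real i} \<noteq> \<infinity>" for i
      using eN[of "real i"] eN0[of "real i"] by (cases "i = 0") auto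
    show "emeasure N X = emeasure L X" if "X \<in> range lessThan" for X
      using that eN eN0 eL by (auto simp: max_def) (metis eN eN0 less_le not_le mult_zero_right ennreal_0)
  qed auto
  have "(\<integral>\<^sup>+z. h ((cmod z)\<^sup>2) \<partial>lborel) = (\<integral>\<^sup>+x. h x \<partial>N)"
    unfolding N_def by (subst nn_integral_distr) auto
  also have "\<dots> = (\<integral>\<^sup>+x. ennreal pi * (h x * indicator {0..} x) \<partial>lborel)"
    unfolding NL L_def by (subst nn_integral_density) (auto simp: mult_ac)
  also have "\<dots> = ennreal pi * (\<integral>\<^sup>+x. h x * indicator {0..} x \<partial>lborel)"
    by (rule nn_integral_cmult) measurable
  finally show ?thesis .
qed

text \<open>This is the bridge from gauge integrals on an interval, where antiderivatives and the
  Beta integral apply, to Lebesgue integrals over a disc.\<close>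

lemma integral_complex_radial:
  fixes h :: "real \<Rightarrow> real"
  assumes I: "(h has_integral I) {0..r}" and nn: "\<And>x. x \<in> {0..r} \<Longrightarrow> 0 \<le> h x"
    and [measurable]: "h \<in> borel_measurable borel" and r: "r \<ge> 0"
  shows "has_bochner_integral lborel (\<lambda>z::complex. indicator (ball 0 (sqrt r)) z * h ((cmod z)\<^sup>2)) (pi * I)"
proof (rule has_bochner_integral_nn_integral)
  have b: "z \<in> ball 0 (sqrt r) \<longleftrightarrow> (cmod z)\<^sup>2 \<in> {..<r}" for z :: complex
    using r by (auto simp: real_less_rsqrt) (metis norm_ge_zero real_sqrt_less_iff real_sqrt_unique)
  have I0: "I \<ge> 0" using I nn by (rule has_integral_nonneg)
  show "0 \<le> pi * I" using I0 by simp
  show "AE z in lborel. 0 \<le> indicator (ball 0 (sqrt r)) z * h ((cmod z)\<^sup>2)"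
    using nn b by (intro always_eventually) (auto simp: indicator_def)
  have "(\<integral>\<^sup>+z. ennreal (indicator (ball 0 (sqrt r)) z * h ((cmod z)\<^sup>2)) \<partial>(lborel::complex measure))
     = (\<integral>\<^sup>+z. (\<lambda>x. ennreal (indicator {..<r} x * h x)) ((cmod z)\<^sup>2) \<partial>(lborel::complex measure))"
    using b by (intro nn_integral_cong) (auto simp: indicator_def)
  also have "\<dots> = ennreal pi * (\<integral>\<^sup>+x. ennreal (indicator {..<r} x * h x) * indicator {0..} x \<partial>lborel)"
    by (rule nn_integral_complex_radial) measurable
  also have "(\<integral>\<^sup>+x. ennreal (indicator {..<r} x * h x) * indicator {0..} x \<partial>lborel)
      = (\<integral>\<^sup>+x. ennreal (h x) * indicator {0..r} x \<partial>lborel)"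
    using AE_lborel_singleton[of r] by (intro nn_integral_cong_AE) (auto simp: indicator_def elim!: eventually_mono)
  also have "\<dots> = (\<integral>\<^sup>+x. ennreal (h x * indicator {0..r} x) \<partial>lborel)"
    by (intro nn_integral_cong) (auto simp: indicator_def)
  also have "\<dots> = ennreal I"
    using I nn by (intro nn_integral_has_integral_lborel)
       (auto simp: indicator_def has_integral_restrict_UNIV[symmetric, of _ _ "{0..r}"] if_distrib of_bool_def cong: if_cong)
  finally show "(\<integral>\<^sup>+z. ennreal (indicator (ball 0 (sqrt r)) z * h ((cmod z)\<^sup>2)) \<partial>(lborel::complex measure)) = ennreal (pi * I)"
    using I0 by (simp add: ennreal_mult)
  show "(\<lambda>z::complex. indicator (ball 0 (sqrt r)) z * h ((cmod z)\<^sup>2)) \<in> borel_measurable lborel"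
    by (intro borel_measurable_times borel_measurable_indicator) measurable
qed

text \<open>Every rotation preserves the integral, hence so does the mean over all of them, and
  Fubini moves the mean inside. This isolates the angular variable without polar
  coordinates.\<close>

lemma integral_complex_average:
  fixes G :: "complex \<Rightarrow> complex"
  assumes G: "integrable lborel G"
  shows "(\<integral>z. G z \<partial>lborel) =
    (\<integral>z. (\<integral>t. indicator {0..1::real} t *\<^sub>R G (exp (2 * of_real pi * \<i> * of_real t) * z) \<partial>lborel) \<partial>lborel)"
proof -
  define e where "e t = exp (2 * of_real pi * \<i> * of_real t)" for t :: real
  have ne: "cmod (e t) = 1" for t by (simp add: e_def)
  have [measurable]: "G \<in> borel_measurable borel" using G by auto
  have [measurable]: "e \<in> borel_measurable borel"
    unfolding e_def by (intro borel_measurable_continuous_onI continuous_intros)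
  have rot: "integrable lborel (\<lambda>z. G (e t * z))" "(\<integral>z. G (e t * z) \<partial>lborel) = (\<integral>z. G z \<partial>lborel)"
    "(\<integral>z. norm (G (e t * z)) \<partial>lborel) = (\<integral>z. norm (G z) \<partial>lborel)" for t
    using G integrable_distr_eq[of "(*) (e t)" lborel borel G] lborel_distr_complex_rotate[OF ne, of t]
      integral_distr[of "(*) (e t)" lborel borel G] integral_distr[of "(*) (e t)" lborel borel "\<lambda>z. norm (G z)"]
    by auto
  define H where "H t z = indicator {0..1::real} t *\<^sub>R G (e t * z)" for t z
  have [measurable]: "(\<lambda>(t, z). H t z) \<in> borel_measurable (lborel \<Otimes>\<^sub>M lborel)"
    unfolding H_def by measurable
  have "integrable (lborel \<Otimes>\<^sub>M lborel) (\<lambda>(t, z). H t z)"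
  proof (rule lborel_pair.Fubini_integrable)
    have "(\<lambda>t. \<integral>z. norm (case (t, z) of (t, z) \<Rightarrow> H t z) \<partial>lborel)
        = (\<lambda>t. indicator {0..1::real} t *\<^sub>R (\<integral>z. norm (G z) \<partial>lborel))"
      by (auto simp: H_def indicator_def rot)
    then show "integrable lborel (\<lambda>t. \<integral>z. norm (case (t, z) of (t, z) \<Rightarrow> H t z) \<partial>lborel)"
      by simp
    show "AE t in lborel. integrable lborel (\<lambda>z. case (t, z) of (t, z) \<Rightarrow> H t z)"
      using rot by (auto simp: H_def)
  qed measurable
  from lborel_pair.Fubini_integral[OF this]
  have "(\<integral>z. (\<integral>t. H t z \<partial>lborel) \<partial>lborel) = (\<integral>t. (\<integral>z. H t z \<partial>lborel) \<partial>lborel)" by simp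
  also have "\<dots> = (\<integral>t. indicator {0..1::real} t *\<^sub>R (\<integral>z. G z \<partial>lborel) \<partial>lborel)"
    by (simp add: H_def rot)
  also have "\<dots> = (\<integral>z. G z \<partial>lborel)" by simp
  finally show ?thesis by (simp add: H_def e_def)
qed

text \<open>For z other than 0, \<open>cnj (e t * z)\<close> equals |z|^2 / (e t * z), so the mean
  is Cauchy's integral for the k-th Taylor coefficient times |z|^(2k).\<close>

lemma integral_circle_coeff:
  fixes g :: "complex \<Rightarrow> complex"
  assumes g: "g holomorphic_on ball 0 R" and z: "z \<in> ball 0 R"
  defines "e \<equiv> \<lambda>t::real. exp (2 * of_real pi * \<i> * of_real t) :: complex"
  shows "(\<integral>t. indicator {0..1::real} t *\<^sub>R (g (e t * z) * cnj (e t * z) ^ k) \<partial>lborel)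
     = (deriv ^^ k) g 0 / fact k * of_real (cmod z ^ (2 * k))"
proof (cases "z = 0")
  case True
  then show ?thesis by (cases k) auto
next
  case False
  have R: "R > 0" using z by (auto simp: dest: order.strict_trans1[OF norm_ge_zero])
  \<comment> \<open>Rescaling moves the circle of radius |z| to the unit circle, where
    \<open>cnj (e t)\<close> is the inverse of \<open>e t\<close>; this is why z = 0 is treated
    apart.\<close>
  define h where "h u = g (z * u)" for u
  have sub: "(\<lambda>u. z * u) ` ball 0 (R / cmod z) \<subseteq> ball 0 R"
    using False by (auto simp: norm_mult field_simps)
  have h: "h holomorphic_on ball 0 (R / cmod z)"
    unfolding h_def using holomorphic_on_compose[of "\<lambda>u. z * u" "ball 0 (R / cmod z)" g]
    holomorphic_on_subset[OF g sub] by (auto simp: o_def intro: holomorphic_intros)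
  have "cball 0 1 \<subseteq> ball (0::complex) (R / cmod z)" using z False
    by (auto simp: field_simps intro!: le_less_trans[OF mult_left_le_one_le[of "cmod z"]])
  then have h1: "h holomorphic_on cball 0 1" using h holomorphic_on_subset by blast
  have dh: "(deriv ^^ k) h 0 = z ^ k * (deriv ^^ k) g 0"
    unfolding h_def using False z R sub
    by (subst higher_deriv_compose_linear[OF g, of "ball 0 (R / cmod z)"]) (auto simp: norm_mult field_simps)
  have "((\<lambda>u. h u / (u - 0) ^ Suc k) has_contour_integral (2 * pi * \<i>) / fact k * (deriv ^^ k) h 0)
      (circlepath 0 1)"
    using h1 by (intro Cauchy_has_contour_integral_higher_derivative_circlepath)
       (auto intro: holomorphic_on_imp_continuous_on holomorphic_on_subset)
  then have "((\<lambda>t. h (circlepath 0 1 t) / circlepath 0 1 t ^ Suc k *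
        vector_derivative (circlepath 0 1) (at t within {0..1})) has_integral
      (2 * pi * \<i>) / fact k * (deriv ^^ k) h 0) {0..1}"
    by (simp add: has_contour_integral_def)
  then have "((\<lambda>t. h (e t) / e t ^ Suc k * (2 * pi * \<i> * e t)) has_integral
      (2 * pi * \<i>) / fact k * (deriv ^^ k) h 0) {0..1}"
  proof (rule has_integral_eq[rotated])
    fix t :: real assume t: "t \<in> {0..1}"
    have "circlepath 0 1 t = e t" by (simp add: circlepath e_def mult_ac)
    moreover have "vector_derivative (circlepath 0 1) (at t within {0..1}) = 2 * pi * \<i> * e t"
      using t by (subst vector_derivative_circlepath01) (auto simp: e_def mult_ac)
    ultimately show "h (circlepath 0 1 t) / circlepath 0 1 t ^ Suc k *
        vector_derivative (circlepath 0 1) (at t within {0..1})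
        = h (e t) / e t ^ Suc k * (2 * pi * \<i> * e t)" by simp
  qed
  then have "((\<lambda>t. (cnj z ^ k / (2 * pi * \<i>)) * (h (e t) / e t ^ Suc k * (2 * pi * \<i> * e t))) has_integral
      (cnj z ^ k / (2 * pi * \<i>)) * ((2 * pi * \<i>) / fact k * (deriv ^^ k) h 0)) {0..1}"
    by (rule has_integral_mult_right)
  moreover have "(cnj z ^ k / (2 * pi * \<i>)) * (h (e t) / e t ^ Suc k * (2 * pi * \<i> * e t))
      = g (e t * z) * cnj (e t * z) ^ k" for t
  proof -
    have "e t \<noteq> 0" by (simp add: e_def)
    moreover have "cnj (e t) * e t = 1"
      by (simp add: e_def exp_cnj flip: exp_add)
    then have "cnj (e t) ^ k * e t ^ k = 1" by (metis power_mult_distrib power_one)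
    ultimately show ?thesis by (simp add: h_def field_simps power_mult_distrib mult.commute)
  qed
  moreover have "(cnj z ^ k / (2 * pi * \<i>)) * ((2 * pi * \<i>) / fact k * (deriv ^^ k) h 0)
      = (deriv ^^ k) g 0 / fact k * of_real (cmod z ^ (2 * k))"
  proof -
    have "complex_of_real (cmod z ^ (2 * k)) = (complex_of_real ((cmod z)\<^sup>2)) ^ k"
      by (simp add: power_mult)
    also have "\<dots> = z ^ k * cnj z ^ k" by (simp only: complex_norm_square power_mult_distrib)
    finally have "complex_of_real (cmod z ^ (2 * k)) = z ^ k * cnj z ^ k" .
    moreover
    have "(c / K) * (K / f * (u * d)) = d / f * (u * c)" if "K \<noteq> 0" for c K f u d :: complex
      using that by simp
    from this[of "2 * pi * \<i>"] have "(cnj z ^ k / (2 * pi * \<i>)) * ((2 * pi * \<i>) / fact k * (z ^ k * (deriv ^^ k) g 0))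
        = (deriv ^^ k) g 0 / fact k * (z ^ k * cnj z ^ k)" by simp
    ultimately show ?thesis by (simp only: dh)
  qed
  ultimately have hi: "((\<lambda>t. g (e t * z) * cnj (e t * z) ^ k) has_integral
      (deriv ^^ k) g 0 / fact k * of_real (cmod z ^ (2 * k))) {0..1}" by simp
  have "continuous_on {0..1} (\<lambda>t. g (e t * z) * cnj (e t * z) ^ k)"
    using z by (intro continuous_intros continuous_on_compose2[OF holomorphic_on_imp_continuous_on[OF g]])
       (auto simp: e_def norm_mult intro!: continuous_intros)
  then have "set_integrable lborel {0..1} (\<lambda>t. g (e t * z) * cnj (e t * z) ^ k)"
    by (rule borel_integrable_atLeastAtMost')
  from set_borel_integral_eq_integral(2)[OF this] hi show ?thesis
    by (simp add: set_lebesgue_integral_def integral_unique)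
qed

text \<open>The indicator and the weight depend on |z| only and pass through the rotation average;
  \<open>integral_circle_coeff\<close> evaluates the rest. Of g only its k-th Taylor coefficient
  survives.\<close>

lemma integral_disc_angular:
  fixes g :: "complex \<Rightarrow> complex"
  assumes g: "g holomorphic_on ball 0 R"
    and int: "integrable lborel (\<lambda>z. indicator (ball 0 R) z *\<^sub>R (g z * cnj z ^ k * of_real (\<omega> (cmod z))))"
  shows "(\<integral>z. indicator (ball 0 R) z *\<^sub>R (g z * cnj z ^ k * of_real (\<omega> (cmod z))) \<partial>lborel)
     = (deriv ^^ k) g 0 / fact k *
       of_real (\<integral>z. indicator (ball 0 R) (z::complex) * (cmod z ^ (2 * k) * \<omega> (cmod z)) \<partial>lborel)"
proof -
  define e where "e t = (exp (2 * of_real pi * \<i> * of_real t) :: complex)" for t :: real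
  have ne: "cmod (e t) = 1" for t by (simp add: e_def)
  have *: "(\<integral>t. indicator {0..1::real} t *\<^sub>R (indicator (ball 0 R) (e t * z) *\<^sub>R
          (g (e t * z) * cnj (e t * z) ^ k * of_real (\<omega> (cmod (e t * z))))) \<partial>lborel)
      = (deriv ^^ k) g 0 / fact k * of_real (indicator (ball 0 R) z * (cmod z ^ (2 * k) * \<omega> (cmod z)))" for z
  proof (cases "z \<in> ball 0 R")
    case True
    have "(\<integral>t. indicator {0..1::real} t *\<^sub>R (indicator (ball 0 R) (e t * z) *\<^sub>R
          (g (e t * z) * cnj (e t * z) ^ k * of_real (\<omega> (cmod (e t * z))))) \<partial>lborel)
      = (\<integral>t. of_real (\<omega> (cmod z)) * (indicator {0..1::real} t *\<^sub>R (g (e t * z) * cnj (e t * z) ^ k)) \<partial>lborel)"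
      using True by (intro Bochner_Integration.integral_cong) (auto simp: norm_mult ne)
    also have "\<dots> = of_real (\<omega> (cmod z)) * ((deriv ^^ k) g 0 / fact k * of_real (cmod z ^ (2 * k)))"
      unfolding e_def by (subst integral_mult_right_zero, subst integral_circle_coeff[OF g True]) simp
    finally show ?thesis using True by simp
  qed (simp add: norm_mult ne)
  show ?thesis
    by (subst integral_complex_average[OF int], fold e_def, subst *)
       (simp only: integral_mult_right_zero integral_complex_of_real)
qed

section \<open>Weighted Bergman spaces of the disc\<close>

text \<open>Cauchy's formula for each \<open>F x y\<close> in x, followed by an exchange of the two
  contour integrals, shows that the integral satisfies Cauchy's formula itself; a continuous
  function represented in this way is differentiable. The result is needed to see that Taylor
  coefficients in one variable are holomorphic in the other.\<close>

lemma holomorphic_contour_integral_circlepath: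
  assumes \<rho>: "\<rho> > 0" and r: "r > 0"
    and cont: "continuous_on (cball 0 \<rho> \<times> sphere 0 r) (\<lambda>(x, y). F x y)"
    and hol: "\<And>y. y \<in> sphere 0 r \<Longrightarrow> (\<lambda>x. F x y) holomorphic_on ball 0 \<rho>"
  shows "(\<lambda>x. contour_integral (circlepath 0 r) (F x)) holomorphic_on ball 0 \<rho>"
proof -
  define I where "I x = contour_integral (circlepath 0 r) (F x)" for x
  let ?v = "\<lambda>t. vector_derivative (circlepath 0 r) (at t)"
  have vc: "continuous_on {0..1} (\<lambda>t. vector_derivative (circlepath 0 s) (at t))" for s
    unfolding vector_derivative_circlepath by (intro continuous_intros)
  have sph: "circlepath 0 s t \<in> sphere 0 s" if "s > 0" for s t
    using that by (simp add: circlepath norm_mult)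
  have "continuous_on (cball 0 \<rho> \<times> cbox 0 1) (\<lambda>(x, t). F x (circlepath 0 r t) * ?v t)"
    unfolding case_prod_beta'
  proof (intro continuous_on_mult)
    have "continuous_on (cball 0 \<rho> \<times> cbox 0 1) (\<lambda>p. (fst p, circlepath 0 r (snd p)))"
      unfolding circlepath by (intro continuous_intros)
    then show "continuous_on (cball 0 \<rho> \<times> cbox 0 1) (\<lambda>p. F (fst p) (circlepath 0 r (snd p)))"
      using sph[OF r] by (auto intro: continuous_on_compose2[OF cont, unfolded case_prod_beta', of _ "\<lambda>p. (fst p, circlepath 0 r (snd p))", simplified])
    show "continuous_on (cball 0 \<rho> \<times> cbox 0 1) (\<lambda>p. ?v (snd p))"
      unfolding vector_derivative_circlepath by (intro continuous_intros)
  qed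
  from integral_continuous_on_param[OF this]
  have Ic: "continuous_on (cball 0 \<rho>) I"
    by (simp add: I_def[abs_def] contour_integral_integral vector_derivative_circlepath)
  \<comment> \<open>The exponent 1 is written out to match the Cauchy kernels of arbitrary order in
    \<open>Cauchy_next_derivative_circlepath\<close>.\<close>
  have hc: "((\<lambda>u. I u / (u - w) ^ 1) has_contour_integral (2 * pi * \<i>) * I w) (circlepath 0 \<rho>)"
    if w: "w \<in> ball 0 \<rho>" for w
  proof -
    have "continuous_on (path_image (circlepath 0 \<rho>)) (\<lambda>u. I u / (u - w))"
      using w \<rho> by (intro continuous_intros continuous_on_subset[OF Ic]) auto
    then have ci: "(\<lambda>u. I u / (u - w)) contour_integrable_on circlepath 0 \<rho>"
      by (rule contour_integrable_continuous_circlepath)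
    have "2 * pi * \<i> * I w = contour_integral (circlepath 0 r) (\<lambda>y. 2 * pi * \<i> * F w y)"
      unfolding I_def
    proof (rule contour_integral_lmul[symmetric])
      have "continuous_on (sphere 0 r) (\<lambda>y. F w y)"
        using w by (intro continuous_on_compose2[OF cont, unfolded case_prod_beta', of _ "\<lambda>y. (w, y)", simplified])
          (auto intro!: continuous_intros)
      then show "F w contour_integrable_on circlepath 0 r"
        using r by (intro contour_integrable_continuous_circlepath) auto
    qed
    also have "\<dots> = contour_integral (circlepath 0 r) (\<lambda>y. contour_integral (circlepath 0 \<rho>) (\<lambda>u. F u y / (u - w)))"
    proof (rule contour_integral_eq)
      fix y assume "y \<in> path_image (circlepath 0 r)"
      then have y: "y \<in> sphere 0 r" using r by simp
      have "((\<lambda>u. F u y / (u - w)) has_contour_integral 2 * of_real pi * \<i> * F w y) (circlepath 0 \<rho>)"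
      proof (rule Cauchy_integral_circlepath)
        show "continuous_on (cball 0 \<rho>) (\<lambda>x. F x y)"
          using y by (intro continuous_on_compose2[OF cont, unfolded case_prod_beta', of _ "\<lambda>x. (x, y)", simplified])
            (auto intro!: continuous_intros)
        show "norm (w - 0) < \<rho>" using w by simp
      qed (rule hol[OF y])
      then show "2 * pi * \<i> * F w y = contour_integral (circlepath 0 \<rho>) (\<lambda>u. F u y / (u - w))"
        by (simp add: contour_integral_unique)
    qed
    also have "\<dots> = contour_integral (circlepath 0 \<rho>) (\<lambda>u. contour_integral (circlepath 0 r) (\<lambda>y. F u y / (u - w)))"
    proof (rule contour_integral_swap)
      show "continuous_on (path_image (circlepath 0 r) \<times> path_image (circlepath 0 \<rho>)) (\<lambda>(y, u). F u y / (u - w))"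
        unfolding case_prod_beta' using r \<rho> w
        by (intro continuous_intros continuous_on_compose2[OF cont, unfolded case_prod_beta', of _ "\<lambda>p. (snd p, fst p)", simplified])
           (auto intro!: continuous_intros)
    qed (auto intro: vc)
    also have "\<dots> = contour_integral (circlepath 0 \<rho>) (\<lambda>u. I u / (u - w))"
    proof (rule contour_integral_eq)
      fix u assume u: "u \<in> path_image (circlepath 0 \<rho>)"
      have "continuous_on (sphere 0 r) (\<lambda>y. F u y)"
        using u \<rho> by (intro continuous_on_compose2[OF cont, unfolded case_prod_beta', of _ "\<lambda>y. (u, y)", simplified])
          (auto intro!: continuous_intros)
      then have "F u contour_integrable_on circlepath 0 r"
        using r by (intro contour_integrable_continuous_circlepath) auto
      then show "contour_integral (circlepath 0 r) (\<lambda>y. F u y / (u - w)) = I u / (u - w)"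
        unfolding I_def by (rule contour_integral_div)
    qed
    finally show ?thesis using has_contour_integral_integral[OF ci] by simp
  qed
  have "I field_differentiable at w" if w: "w \<in> ball 0 \<rho>" for w
  proof -
    have "continuous_on (path_image (circlepath 0 \<rho>)) I"
      using \<rho> by (intro continuous_on_subset[OF Ic]) auto
    from Cauchy_next_derivative_circlepath(2)[OF this hc _ w]
    have "(\<lambda>w. 2 * pi * \<i> * I w) field_differentiable at w"
      by (auto simp: field_differentiable_def)
    then have "(\<lambda>w. 1 / (2 * pi * \<i>) * (2 * pi * \<i> * I w)) field_differentiable at w"
      by (rule field_differentiable_mult[OF field_differentiable_const])
    then show ?thesis by simp
  qed
  then show ?thesis
    unfolding I_def[symmetric] by (auto simp: holomorphic_on_def intro: field_differentiable_at_within)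
qed

section \<open>Taylor coefficients, moments and binomial series on the disc\<close>

lemma higher_deriv_coeff_circlepath:
  assumes "continuous_on (cball 0 r) g" "g holomorphic_on ball 0 r" "r > 0"
  shows "(deriv ^^ k) g 0 / fact k = contour_integral (circlepath 0 r) (\<lambda>u. g u / u ^ Suc k) / (2 * pi * \<i>)"
  using contour_integral_unique[OF Cauchy_has_contour_integral_higher_derivative_circlepath[OF assms(1,2), of 0 k]] assms(3)
  by simp

lemma moment_disc:
  assumes "r \<ge> 0"
  shows "(\<integral>z. indicator (ball 0 (sqrt r)) (z::complex) * cmod z ^ (2 * k) \<partial>lborel) = pi * r ^ Suc k / Suc k"
proof -
  have "((\<lambda>x. x ^ k) has_integral (r ^ Suc k / Suc k - 0 ^ Suc k / Suc k)) {0..r}"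
  proof (intro fundamental_theorem_of_calculus)
    fix x
    have "((\<lambda>x. x ^ Suc k / Suc k) has_real_derivative x ^ k) (at x)"
      using DERIV_cdivide[OF DERIV_pow[of "Suc k" x], of "real (Suc k)"] by simp
    then show "((\<lambda>x. x ^ Suc k / Suc k) has_vector_derivative x ^ k) (at x within {0..r})"
      by (simp only: has_real_derivative_iff_has_vector_derivative has_vector_derivative_at_within)
  qed (use assms in auto)
  from integral_complex_radial[OF this] assms show ?thesis
    by (auto simp: power_mult has_bochner_integral_iff)
qed

lemma moment_weighted_disc:
  fixes \<alpha> :: real
  assumes \<alpha>: "\<alpha> > -1"
  shows "has_bochner_integral lborel
    (\<lambda>z::complex. indicator (ball 0 1) z * (cmod z ^ (2 * k) * (1 - (cmod z)\<^sup>2) powr \<alpha>))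
    (pi * Beta (Suc k) (\<alpha> + 1))"
proof -
  have "((\<lambda>t. t powr (real (Suc k) - 1) * (1 - t) powr (\<alpha> + 1 - 1)) has_integral Beta (Suc k) (\<alpha> + 1)) {0..1::real}"
    using \<alpha> by (intro has_integral_Beta_real) auto
  then have "((\<lambda>t. t ^ k * (1 - t) powr \<alpha>) has_integral Beta (Suc k) (\<alpha> + 1)) {0..1::real}"
    \<comment> \<open>For k = 0 the integrands differ at t = 0, because \<open>0 powr 0\<close> is 0
      while \<open>0 ^ 0\<close> is 1.\<close>
    by (rule has_integral_spike[of "{0}", rotated 2]) (auto simp: powr_realpow)
  from integral_complex_radial[OF this] show ?thesis
    by (simp flip: power_mult)
qed

text \<open>The fraction is the k-th Taylor coefficient of (1 - s) powr (- \<alpha> - 2), and the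
  Beta value is the k-th radial moment of the weight up to pi. That their product does not depend on
  k is the reason why a pure power is the weighted kernel.\<close>

lemma pochhammer_Beta:
  fixes \<alpha> :: real
  assumes "\<alpha> > -1"
  shows "pochhammer (\<alpha> + 2) k / fact k * Beta (Suc k) (\<alpha> + 1) = 1 / (\<alpha> + 1)"
proof -
  have pos: "x \<notin> \<int>\<^sub>\<le>\<^sub>0" if "x > 0" for x :: real
    using that by (auto elim!: nonpos_Ints_cases)
  have "pochhammer (\<alpha> + 2) k = Gamma (\<alpha> + 2 + k) / Gamma (\<alpha> + 2)"
    using assms by (intro pochhammer_Gamma pos) auto
  moreover have "Gamma (\<alpha> + 2) = (\<alpha> + 1) * Gamma (\<alpha> + 1)"
    using Gamma_plus1[OF pos, of "\<alpha> + 1"] assms by (simp add: add.commute)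
  moreover have "Gamma (real (Suc k)) = fact k" using Gamma_fact[of k, where 'a=real] by simp
  moreover have "Gamma (\<alpha> + 2 + k) > 0" "Gamma (\<alpha> + 1) > 0"
    using assms by (auto intro!: Gamma_real_pos)
  moreover have "real (Suc k) + (\<alpha> + 1) = \<alpha> + 2 + k" by simp
  moreover have "A / ((\<alpha> + 1) * B) / f * (f * B / A) = 1 / (\<alpha> + 1)" if "A > 0" "B > 0" "f \<noteq> 0" for A B f :: real
    using that assms by simp
  ultimately show ?thesis unfolding Beta_def by (simp only: fact_nonzero not_False_eq_True)
qed

text \<open>Rising factorials absorb the signs of the binomial coefficients. For b > 0 all
  coefficients are then positive, so the same series at a real point majorises the complex
  one.\<close>

lemma one_minus_powr_sums:
  fixes w :: complex
  assumes "cmod w < 1"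
  shows "(\<lambda>j. of_real (pochhammer b j / fact j) * w ^ j) sums (1 - w) powr of_real (- b)"
proof -
  have "(of_real (- b) gchoose j) * (- w) ^ j = of_real (pochhammer b j / fact j) * w ^ j" for j
  proof -
    have "(- 1) ^ j * (- w) ^ j = w ^ j" by (simp flip: power_mult_distrib)
    moreover have "(of_real (- b) gchoose j) * (- w) ^ j
        = of_real (pochhammer b j / fact j) * ((- 1) ^ j * (- w) ^ j)"
      by (simp add: gbinomial_pochhammer pochhammer_of_real)
    ultimately show ?thesis by simp
  qed
  then show ?thesis using gen_binomial_complex[of "- w" "of_real (- b)"] assms by simp
qed

lemma one_minus_powr_summable:
  fixes x :: real
  assumes "\<bar>x\<bar> < 1"
  shows "summable (\<lambda>j. pochhammer b j / fact j * x ^ j)"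
proof -
  have "summable (\<lambda>j. complex_of_real (pochhammer b j / fact j * x ^ j))"
    using sums_summable[OF one_minus_powr_sums[of "of_real x" b]] assms
    by (simp only: of_real_mult of_real_power norm_of_real)
  then show ?thesis by (simp only: summable_complex_of_real)
qed

lemma norm_mult_cnj_less_1:
  assumes "cmod z < 1" "cmod x < 1"
  shows "cmod (z * cnj x) < 1"
  using mult_strict_mono'[OF assms] by (simp add: norm_mult)

text \<open>Expanding the power in z * cnj \<zeta> and integrating termwise, the j-th term extracts
  the j-th Taylor coefficient of g; by \<open>pochhammer_Beta\<close> all terms carry the same
  factor, so the Taylor series of g at z reappears.\<close>

lemma weighted_bergman_disc:
  fixes g :: "complex \<Rightarrow> complex" and \<alpha> :: real
  assumes \<alpha>: "\<alpha> > -1" and g: "g holomorphic_on ball 0 1" and z: "cmod z < 1"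
    and int: "integrable lborel (\<lambda>\<zeta>. indicator (ball 0 1) \<zeta> *\<^sub>R (g \<zeta> * of_real ((1 - (cmod \<zeta>)\<^sup>2) powr \<alpha>)))"
  shows "(\<integral>\<zeta>. indicator (ball 0 1) \<zeta> *\<^sub>R (g \<zeta> * of_real ((1 - (cmod \<zeta>)\<^sup>2) powr \<alpha>)
            * (1 - z * cnj \<zeta>) powr of_real (- (\<alpha> + 2))) \<partial>lborel) = pi / (\<alpha> + 1) * g z"
proof -
  define w where "w x = (1 - x\<^sup>2) powr \<alpha>" for x :: real
  define b where "b j = pochhammer (\<alpha> + 2) j / fact j" for j
  have b0: "b j \<ge> 0" for j using \<alpha> by (auto simp: b_def intro!: divide_nonneg_nonneg less_imp_le[OF pochhammer_pos])
  define q :: "complex \<Rightarrow> complex" where "q \<zeta> = indicator (ball 0 1) \<zeta> *\<^sub>R (g \<zeta> * of_real (w (cmod \<zeta>)))" for \<zeta> :: complex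
  have q: "integrable lborel q" using int by (simp add: q_def[abs_def] w_def)
  then have [measurable]: "q \<in> borel_measurable borel" by auto
  define T :: "nat \<Rightarrow> complex \<Rightarrow> complex" where "T j \<zeta> = q \<zeta> * (of_real (b j) * (z * cnj \<zeta>) ^ j)" for j \<zeta>
  have [measurable]: "cnj \<in> borel_measurable borel"
    by (intro borel_measurable_continuous_onI continuous_intros)
  have mT: "T j \<in> borel_measurable lborel" for j
    unfolding T_def by measurable
  \<comment> \<open>Powers of \<zeta> are at most 1 in modulus on the disc, so the majorant depends
    on z alone and |z| < 1 makes it summable.\<close>
  have nT: "norm (T j \<zeta>) \<le> (b j * cmod z ^ j) * norm (q \<zeta>)" for j \<zeta>
  proof (cases "\<zeta> \<in> ball 0 1")
    case True
    have "norm (T j \<zeta>) = (b j * cmod z ^ j) * norm (q \<zeta>) * cmod \<zeta> ^ j"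
      by (simp add: T_def norm_mult norm_power b0 power_mult_distrib)
    also have "\<dots> \<le> (b j * cmod z ^ j) * norm (q \<zeta>) * 1"
      using True b0 by (intro mult_left_mono power_le_one mult_nonneg_nonneg) auto
    finally show ?thesis by simp
  qed (simp add: T_def q_def)
  have iT: "integrable lborel (T j)" for j
    by (rule Bochner_Integration.integrable_bound[of _ "\<lambda>\<zeta>. (b j * cmod z ^ j) * norm (q \<zeta>)"])
       (use q nT b0 mT in \<open>auto intro!: order_trans[OF nT] always_eventually\<close>)
  have sb: "summable (\<lambda>j. b j * cmod z ^ j)"
    unfolding b_def using z by (intro one_minus_powr_summable) auto
  have s1: "AE \<zeta> in lborel. summable (\<lambda>j. norm (T j \<zeta>))"
    using nT b0 by (intro always_eventually allI summable_comparison_test'[OF summable_mult2[OF sb]]) auto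
  have s2: "summable (\<lambda>j. \<integral>\<zeta>. norm (T j \<zeta>) \<partial>lborel)"
  proof (rule summable_comparison_test'[OF summable_mult2[OF sb]])
    fix j
    have "(\<integral>\<zeta>. norm (T j \<zeta>) \<partial>lborel) \<le> (\<integral>\<zeta>. (b j * cmod z ^ j) * norm (q \<zeta>) \<partial>lborel)"
      using iT q nT by (intro integral_mono) auto
    then show "norm (\<integral>\<zeta>. norm (T j \<zeta>) \<partial>lborel) \<le> (b j * cmod z ^ j) * (\<integral>\<zeta>. norm (q \<zeta>) \<partial>lborel)"
      by simp
  qed
  have "(\<lambda>j. \<integral>\<zeta>. T j \<zeta> \<partial>lborel) sums (\<integral>\<zeta>. (suminf (\<lambda>j. T j \<zeta>)) \<partial>lborel)"
    by (rule sums_integral[OF iT s1 s2])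
  moreover have "(suminf (\<lambda>j. T j \<zeta>)) = indicator (ball 0 1) \<zeta> *\<^sub>R (g \<zeta> * of_real ((1 - (cmod \<zeta>)\<^sup>2) powr \<alpha>)
            * (1 - z * cnj \<zeta>) powr of_real (- (\<alpha> + 2)))" for \<zeta>
  proof (cases "\<zeta> \<in> ball 0 1")
    case True
    then have "cmod (z * cnj \<zeta>) < 1" using z by (intro norm_mult_cnj_less_1) auto
    from sums_unique[OF sums_mult[OF one_minus_powr_sums[OF this, of "\<alpha> + 2"], of "q \<zeta>"]] True
    show ?thesis by (simp add: T_def b_def q_def w_def)
  qed (simp add: T_def q_def)
  moreover have "(\<integral>\<zeta>. T j \<zeta> \<partial>lborel) = pi / (\<alpha> + 1) * ((deriv ^^ j) g 0 / fact j * (z - 0) ^ j)" for j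
  proof -
    have eq: "indicator (ball 0 1) \<zeta> *\<^sub>R (g \<zeta> * cnj \<zeta> ^ j * of_real (w (cmod \<zeta>))) = q \<zeta> * cnj \<zeta> ^ j" for \<zeta>
      by (simp add: q_def)
    have "integrable lborel (\<lambda>\<zeta>. q \<zeta> * cnj \<zeta> ^ j)"
    proof (rule Bochner_Integration.integrable_bound[OF q])
      show "(\<lambda>\<zeta>. q \<zeta> * cnj \<zeta> ^ j) \<in> borel_measurable lborel" by measurable
      have "norm (q \<zeta> * cnj \<zeta> ^ j) \<le> norm (q \<zeta>)" for \<zeta>
        by (cases "\<zeta> \<in> ball 0 1")
           (auto simp: norm_mult norm_power q_def intro!: mult_right_le_one_le power_le_one)
      then show "AE \<zeta> in lborel. norm (q \<zeta> * cnj \<zeta> ^ j) \<le> norm (q \<zeta>)" by simp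
    qed
    then have *: "(\<integral>\<zeta>. q \<zeta> * cnj \<zeta> ^ j \<partial>lborel) = (deriv ^^ j) g 0 / fact j * of_real (pi * Beta (Suc j) (\<alpha> + 1))"
      using integral_disc_angular[OF g, of j w] has_bochner_integral_integral_eq[OF moment_weighted_disc[OF \<alpha>, of j]]
      unfolding eq by (simp add: w_def)
    have "(\<integral>\<zeta>. T j \<zeta> \<partial>lborel) = (\<integral>\<zeta>. (of_real (b j) * z ^ j) * (q \<zeta> * cnj \<zeta> ^ j) \<partial>lborel)"
      by (simp add: T_def power_mult_distrib mult_ac)
    also have "\<dots> = of_real (b j * Beta (Suc j) (\<alpha> + 1)) * (pi * ((deriv ^^ j) g 0 / fact j * z ^ j))"
      by (subst integral_mult_right_zero, subst *) simp
    also have "b j * Beta (Suc j) (\<alpha> + 1) = 1 / (\<alpha> + 1)"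
      unfolding b_def by (rule pochhammer_Beta[OF \<alpha>])
    finally show ?thesis by simp
  qed
  moreover have "(\<lambda>j. pi / (\<alpha> + 1) * ((deriv ^^ j) g 0 / fact j * (z - 0) ^ j)) sums (pi / (\<alpha> + 1) * g z)"
    using z by (intro sums_mult holomorphic_power_series[OF g]) auto
  ultimately show ?thesis by (simp add: sums_unique2)
qed

section \<open>The kernel of the Hartogs domain\<close>

text \<open>Pairs are used instead of points of \<open>Cn 2\<close> so that Fubini and one-variable
  holomorphy apply to the coordinates directly; \<open>E2\<close> transports the results
  later.\<close>

definition hartogs :: "real \<Rightarrow> (complex \<times> complex) set" where
  "hartogs a = {(x, y). cmod x < 1 \<and> (cmod y)\<^sup>2 < (1 - (cmod x)\<^sup>2) powr a}"

text \<open>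
  The product of the reciprocals of \<open>\<pi> / (k + 1)\<close>, the integral of \<open>\<bar>y\<bar>\<^sup>2\<^sup>k\<close> over the unit disc, and
  \<open>\<pi> / (a (k + 1) + 1)\<close>, the mass of the weight \<open>(1 - \<bar>x\<bar>\<^sup>2) powr (a (k + 1))\<close>.
\<close>
definition kernel_coeff :: "real \<Rightarrow> nat \<Rightarrow> real" where
  "kernel_coeff a k = (real k + 1) * (a * (real k + 1) + 1) / pi\<^sup>2"

definition kernel_term :: "real \<Rightarrow> complex \<Rightarrow> complex \<Rightarrow> nat \<Rightarrow> complex" where
  "kernel_term a s t k = of_real (kernel_coeff a k) * t ^ k * (1 - s) powr of_real (- (a * (real k + 1) + 2))"

text \<open>The closed form of the sum of \<open>kernel_term\<close>: the k-th term is (1 - s) powr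
  (- a - 2) times \<open>kernel_coeff a k\<close> times u^k, the series of (k + 1)^2 u^k is (1 + u)
  / (1 - u)^3, and that of (k + 1) u^k is 1 / (1 - u)^2.\<close>

definition hartogs_kernel :: "real \<Rightarrow> complex \<Rightarrow> complex \<Rightarrow> complex" where
  "hartogs_kernel a s t = (let u = t * (1 - s) powr of_real (- a) in
     (1 - s) powr of_real (- (a + 2)) * (of_real a * (1 + u) / (1 - u) ^ 3 + 1 / (1 - u) ^ 2) / of_real (pi\<^sup>2))"

lemma kernel_coeff_pos: "a > 0 \<Longrightarrow> kernel_coeff a k > 0"
  by (auto simp: kernel_coeff_def intro!: divide_pos_pos mult_pos_pos add_nonneg_pos)

section \<open>Summation of the kernel series\<close>

lemma pochhammer_div_fact_Suc:
  "pochhammer (b::real) (Suc k) / fact (Suc k) = pochhammer b k / fact k * ((b + real k) / (real k + 1))"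
  by (simp add: pochhammer_Suc add.commute)

lemma pochhammer_2_fact: "pochhammer (2::real) k / fact k = real k + 1"
proof (induction k)
  case (Suc k)
  show ?case unfolding pochhammer_div_fact_Suc Suc by (simp add: field_simps)
qed simp

lemma pochhammer_3_fact: "pochhammer (3::real) k / fact k = (real k + 1) * (real k + 2) / 2"
proof (induction k)
  case (Suc k)
  show ?case unfolding pochhammer_div_fact_Suc Suc by (simp add: field_simps)
qed simp

text \<open>Splitting into the coefficients of (1 - u)^(-3) and (1 - u)^(-2) lets the binomial
  series do the summation.\<close>

lemma kernel_coeff_eq:
  "kernel_coeff a k = (2 * a * (pochhammer 3 k / fact k) + (1 - a) * (pochhammer 2 k / fact k)) / pi\<^sup>2"
  unfolding pochhammer_2_fact pochhammer_3_fact kernel_coeff_def by (simp add: field_simps)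

lemma kernel_coeff_sums:
  assumes "cmod u < 1"
  shows "(\<lambda>k. of_real (kernel_coeff a k) * u ^ k) sums
    ((of_real a * (1 + u) / (1 - u) ^ 3 + 1 / (1 - u) ^ 2) / of_real (pi\<^sup>2))"
proof -
  have u: "1 - u \<noteq> 0" using assms by auto
  have p: "(1 - u) powr of_real (- real n) = 1 / (1 - u) ^ n" for n
    using u powr_minus[of "1 - u" "of_nat n"] by (simp add: powr_nat' field_simps)
  have "(\<lambda>k. (2 * of_real a * (of_real (pochhammer 3 k / fact k) * u ^ k)
      + (1 - of_real a) * (of_real (pochhammer 2 k / fact k) * u ^ k)) / of_real (pi\<^sup>2))
    sums ((2 * of_real a * (1 - u) powr of_real (- 3) + (1 - of_real a) * (1 - u) powr of_real (- 2)) / of_real (pi\<^sup>2))"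
    by (intro sums_divide sums_add sums_mult one_minus_powr_sums assms)
  also have "(\<lambda>k. (2 * of_real a * (of_real (pochhammer 3 k / fact k) * u ^ k)
      + (1 - of_real a) * (of_real (pochhammer 2 k / fact k) * u ^ k)) / of_real (pi\<^sup>2))
     = (\<lambda>k. of_real (kernel_coeff a k) * u ^ k)"
    unfolding kernel_coeff_eq by (simp add: field_simps)
  also have "2 * of_real a * (1 - u) powr of_real (- 3) + (1 - of_real a) * (1 - u) powr of_real (- 2)
      = of_real a * (1 + u) / (1 - u) ^ 3 + 1 / (1 - u) ^ 2"
  proof -
    have "2 * of_real a * (1 / v ^ 3) + (1 - of_real a) * (1 / v ^ 2) = of_real a * (2 - v) / v ^ 3 + 1 / v ^ 2"
      if "v \<noteq> 0" for v :: complex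
      using that by (simp add: field_simps power2_eq_square power3_eq_cube)
    from this[OF u] show ?thesis using p[of 3] p[of 2] by simp
  qed
  finally show ?thesis .
qed

lemma kernel_coeff_summable:
  assumes "\<bar>x\<bar> < 1"
  shows "summable (\<lambda>k. kernel_coeff a k * x ^ k)"
proof -
  have "summable (\<lambda>k. complex_of_real (kernel_coeff a k * x ^ k))"
    using sums_summable[OF kernel_coeff_sums[of "of_real x" a]] assms
    by (simp only: of_real_mult of_real_power norm_of_real)
  then show ?thesis by (simp only: summable_complex_of_real)
qed

lemma norm_one_minus_powr_le:
  assumes "cmod s < 1" "b \<ge> 0"
  shows "cmod ((1 - s) powr of_real (- b)) \<le> (1 - cmod s) powr (- b)"
proof -
  have "1 - cmod s \<le> cmod (1 - s)" using norm_triangle_ineq2[of 1 s] by simp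
  then have "cmod (1 - s) powr (- b) \<le> (1 - cmod s) powr (- b)"
    using assms by (intro powr_mono2') auto
  then show ?thesis by (simp add: norm_powr_real_powr')
qed

lemma kernel_term_sums:
  assumes s: "cmod s < 1" and u: "cmod (t * (1 - s) powr of_real (- a)) < 1"
  shows "kernel_term a s t sums hartogs_kernel a s t"
proof -
  define u where "u = t * (1 - s) powr of_real (- a)"
  have ns: "1 - s \<noteq> 0" using s by auto
  have "(\<lambda>k. (1 - s) powr of_real (- (a + 2)) * (of_real (kernel_coeff a k) * u ^ k)) sums
     ((1 - s) powr of_real (- (a + 2)) * ((of_real a * (1 + u) / (1 - u) ^ 3 + 1 / (1 - u) ^ 2) / of_real (pi\<^sup>2)))"
    using u by (intro sums_mult kernel_coeff_sums) (simp add: u_def)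
  moreover have "(1 - s) powr of_real (- (a + 2)) * (of_real (kernel_coeff a k) * u ^ k) = kernel_term a s t k" for k
  proof -
    \<comment> \<open>Raising to a natural power commutes with the principal branch, since only the
      exponent of exp is multiplied; for general exponents this could fail.\<close>
    have "((1 - s) powr of_real (- a)) ^ k = (1 - s) powr of_real (- (a * real k))"
      using ns by (simp add: powr_def exp_of_nat_mult[symmetric] mult_ac)
    moreover have "(1 - s) powr of_real (- (a + 2)) * (1 - s) powr of_real (- (a * real k))
        = (1 - s) powr of_real (- (a * (real k + 1) + 2))"
      unfolding powr_add[symmetric] of_real_add[symmetric] by (simp add: algebra_simps)
    ultimately show ?thesis
      by (simp only: u_def power_mult_distrib kernel_term_def mult_ac)
  qed
  ultimately show ?thesis by (simp add: hartogs_kernel_def u_def Let_def)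
qed

lemma norm_kernel_term:
  assumes s: "cmod s < 1" and a: "a > 0"
  shows "cmod (kernel_term a s t k) \<le>
    kernel_coeff a k * (cmod t * (1 - cmod s) powr (- a)) ^ k * (1 - cmod s) powr (- (a + 2))"
proof -
  have "cmod (kernel_term a s t k) = kernel_coeff a k * cmod t ^ k * cmod ((1 - s) powr of_real (- (a * (real k + 1) + 2)))"
    using kernel_coeff_pos[OF a, of k] by (simp add: kernel_term_def norm_mult norm_power)
  also have "\<dots> \<le> kernel_coeff a k * cmod t ^ k * (1 - cmod s) powr (- (a * (real k + 1) + 2))"
    using kernel_coeff_pos[OF a, of k] a by (intro mult_left_mono norm_one_minus_powr_le s) auto
  also have "(1 - cmod s) powr (- (a * (real k + 1) + 2)) = ((1 - cmod s) powr (- a)) ^ k * (1 - cmod s) powr (- (a + 2))"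
    using s by (simp add: powr_powr powr_add[symmetric] algebra_simps flip: powr_realpow)
  finally show ?thesis by (simp add: power_mult_distrib mult_ac)
qed

text \<open>The third bound uses the Cauchy--Schwarz inequality \<open>(1 - p\<^sup>2) (1 - q\<^sup>2) \<le> (1 - p q)\<^sup>2\<close>.\<close>
lemma hartogs_ratio_le:
  assumes a: "a > 0" and zw: "(z, w) \<in> hartogs a" and xy: "(x, y) \<in> hartogs a"
  shows "cmod (z * cnj x) \<le> cmod z" "cmod z < 1"
    "cmod (w * cnj y) * (1 - cmod (z * cnj x)) powr (- a) \<le> cmod w * (1 - (cmod z)\<^sup>2) powr (- (a / 2))"
    "cmod w * (1 - (cmod z)\<^sup>2) powr (- (a / 2)) < 1"
proof -
  define p q where "p = cmod z" and "q = cmod x"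
  have p: "0 \<le> p" "p < 1" and q: "0 \<le> q" "q < 1"
    and w: "(cmod w)\<^sup>2 < (1 - p\<^sup>2) powr a" and y: "(cmod y)\<^sup>2 < (1 - q\<^sup>2) powr a"
    using zw xy by (auto simp: hartogs_def p_def q_def)
  have p2: "1 - p\<^sup>2 > 0" and q2: "1 - q\<^sup>2 > 0" and pq: "1 - p * q > 0"
    using p q by (simp_all add: power_less_one_iff abs_square_less_1)
      (metis less_eq_real_def mult_le_one mult_strict_mono' mult_1 mult_less_cancel_left2 not_less)
  show "cmod (z * cnj x) \<le> cmod z" "cmod z < 1"
    using p q by (auto simp: norm_mult p_def q_def intro: mult_right_le_one_le)
  have sq: "v < r powr (a / 2)" if "v\<^sup>2 < r powr a" "r > 0" "v \<ge> 0" for v r :: real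
  proof (rule power2_less_imp_less)
    show "v\<^sup>2 < (r powr (a / 2))\<^sup>2" using that by (simp add: powr_powr flip: powr_realpow powr_numeral)
  qed auto
  have w': "cmod w < (1 - p\<^sup>2) powr (a / 2)" and y': "cmod y < (1 - q\<^sup>2) powr (a / 2)"
    using sq w y p2 q2 by auto
  show "cmod w * (1 - (cmod z)\<^sup>2) powr (- (a / 2)) < 1"
    using w' p2 by (simp add: powr_minus p_def field_simps)
  have "(1 - p\<^sup>2) * (1 - q\<^sup>2) \<le> (1 - p * q)\<^sup>2"
    using sum_squares_bound[of p q] by (simp add: algebra_simps power2_eq_square)
  then have "((1 - p\<^sup>2) * (1 - q\<^sup>2)) powr (a / 2) \<le> ((1 - p * q)\<^sup>2) powr (a / 2)"
    using a p2 q2 by (intro powr_mono2) auto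
  then have cs: "(1 - p\<^sup>2) powr (a / 2) * (1 - q\<^sup>2) powr (a / 2) \<le> (1 - p * q) powr a"
    using p2 q2 pq by (simp add: powr_mult powr_powr flip: powr_realpow powr_numeral)
  have "cmod w * cmod y * (1 - p\<^sup>2) powr (a / 2) \<le> cmod w * (1 - q\<^sup>2) powr (a / 2) * (1 - p\<^sup>2) powr (a / 2)"
    using y' by (intro mult_right_mono mult_left_mono) auto
  also have "\<dots> \<le> cmod w * (1 - p * q) powr a"
    using cs by (simp only: mult.assoc mult.commute[of "(1 - q\<^sup>2) powr _"]) (intro mult_left_mono; simp)
  finally have "cmod w * cmod y * (1 - p\<^sup>2) powr (a / 2) \<le> cmod w * (1 - p * q) powr a" .
  then show "cmod (w * cnj y) * (1 - cmod (z * cnj x)) powr (- a) \<le> cmod w * (1 - (cmod z)\<^sup>2) powr (- (a / 2))"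
    using p2 pq by (simp add: norm_mult powr_minus field_simps flip: p_def q_def)
qed

lemma hartogs_parameters:
  assumes "a > 0" "(z, w) \<in> hartogs a" "(x, y) \<in> hartogs a"
  shows "cmod (z * cnj x) < 1" "cmod (w * cnj y * (1 - z * cnj x) powr of_real (- a)) < 1"
proof -
  note r = hartogs_ratio_le[OF assms]
  show s: "cmod (z * cnj x) < 1" using r by linarith
  have "cmod (w * cnj y * (1 - z * cnj x) powr of_real (- a)) \<le> cmod (w * cnj y) * (1 - cmod (z * cnj x)) powr (- a)"
    using norm_one_minus_powr_le[OF s, of a] assms(1) unfolding norm_mult[of "w * cnj y"] by (intro mult_left_mono) auto
  then show "cmod (w * cnj y * (1 - z * cnj x) powr of_real (- a)) < 1" using r by linarith
qed

section \<open>Shape of the Hartogs domain and its Taylor coefficients along fibres\<close>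

definition hartogs_radius :: "real \<Rightarrow> complex \<Rightarrow> real" where
  "hartogs_radius a x = sqrt ((1 - (cmod x)\<^sup>2) powr a)"

lemma square_norm_less_1: "cmod x < 1 \<Longrightarrow> (cmod x)\<^sup>2 < 1"
  by (simp add: abs_square_less_1)

lemma hartogs_norm_less_1:
  assumes "(x, y) \<in> hartogs a" "a > 0"
  shows "cmod x < 1" "cmod y < 1"
proof -
  have x: "cmod x < 1" and y: "(cmod y)\<^sup>2 < (1 - (cmod x)\<^sup>2) powr a"
    using assms by (auto simp: hartogs_def)
  have "(1 - (cmod x)\<^sup>2) powr a \<le> 1 powr a"
    using assms square_norm_less_1[OF x] by (intro powr_mono2) auto
  then have "(cmod y)\<^sup>2 < 1" using y by simp
  then show "cmod y < 1" by (simp add: abs_square_less_1)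
qed (use assms in \<open>auto simp: hartogs_def\<close>)

lemma hartogs_radius_pos: "cmod x < 1 \<Longrightarrow> hartogs_radius a x > 0"
  using square_norm_less_1[of x] by (simp add: hartogs_radius_def)

lemma hartogs_iff: "(x, y) \<in> hartogs a \<longleftrightarrow> x \<in> ball 0 1 \<and> y \<in> ball 0 (hartogs_radius a x)"
proof -
  have "cmod y < sqrt r \<longleftrightarrow> (cmod y)\<^sup>2 < r" for r
    by (metis real_sqrt_less_iff real_sqrt_abs abs_of_nonneg norm_ge_zero)
  then show ?thesis by (simp add: hartogs_def hartogs_radius_def)
qed

text \<open>The fibre radius decreases as |x| grows. This gives closed polydiscs for the coefficient
  integrals, and star-shapedness about the origin.\<close>

lemma hartogs_subset:
  assumes "(x, y) \<in> hartogs a" "cmod x' \<le> cmod x" "cmod y' \<le> cmod y" "a > 0"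
  shows "(x', y') \<in> hartogs a"
proof -
  have x: "cmod x < 1" and y: "(cmod y)\<^sup>2 < (1 - (cmod x)\<^sup>2) powr a"
    using assms by (auto simp: hartogs_def)
  have "(cmod x')\<^sup>2 \<le> (cmod x)\<^sup>2" using assms by (intro power_mono) auto
  then have "(1 - (cmod x)\<^sup>2) powr a \<le> (1 - (cmod x')\<^sup>2) powr a"
    using assms square_norm_less_1[OF x] by (intro powr_mono2) auto
  moreover have "(cmod y')\<^sup>2 \<le> (cmod y)\<^sup>2" using assms by (intro power_mono) auto
  ultimately have "(cmod y')\<^sup>2 < (1 - (cmod x')\<^sup>2) powr a" using y by linarith
  then show ?thesis using assms x by (simp add: hartogs_def)
qed

lemma continuous_on_one_minus_powr:
  fixes g :: "'a::topological_space \<Rightarrow> complex"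
  assumes "continuous_on S g" "\<And>p. p \<in> S \<Longrightarrow> cmod (g p) < 1"
  shows "continuous_on S (\<lambda>p. (1 - g p) powr c)"
proof (rule continuous_on_powr_complex)
  have "Re (1 - g p) > 0" if "p \<in> S" for p
    using complex_Re_le_cmod[of "g p"] assms(2)[OF that] by simp
  then show "S \<subseteq> {p. Re (1 - g p) \<ge> 0 \<or> Im (1 - g p) \<noteq> 0}"
    "\<And>p. p \<in> S \<Longrightarrow> 1 - g p = 0 \<Longrightarrow> Re c > 0"
    by (force intro: less_imp_le)+
qed (intro continuous_intros assms)+

lemma open_hartogs: "a > 0 \<Longrightarrow> open (hartogs a)"
proof -
  assume a: "a > 0"
  \<comment> \<open>Truncation at 0 gives a function continuous everywhere, as a > 0. Since
    \<open>0 powr a\<close> is 0, the strict inequality admits no point with |x| >= 1.\<close>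
  have c: "continuous_on UNIV (\<lambda>p::complex \<times> complex. (max 0 (1 - (cmod (fst p))\<^sup>2)) powr a)"
    by (rule continuous_on_powr'[rotated 2]) (use a in \<open>auto intro!: continuous_intros\<close>)
  then have "open {p::complex \<times> complex. (cmod (snd p))\<^sup>2 < (max 0 (1 - (cmod (fst p))\<^sup>2)) powr a}"
    by (intro open_Collect_less[OF _ c] continuous_intros)
  also have "{p::complex \<times> complex. (cmod (snd p))\<^sup>2 < (max 0 (1 - (cmod (fst p))\<^sup>2)) powr a} = hartogs a"
  proof -
    have "(cmod y)\<^sup>2 < (max 0 (1 - (cmod x)\<^sup>2)) powr a \<longleftrightarrow> (x, y) \<in> hartogs a" for x y
      by (cases "cmod x < 1") (auto simp: hartogs_def max_def not_less dest: square_norm_less_1 power_mono[of 1 _ 2])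
    then show ?thesis by auto
  qed
  finally show ?thesis .
qed

text \<open>The coefficient is a Cauchy integral over a circle in the fibre. For |x| \<le> \<rho> <
  1 one circle serves all fibres, so holomorphy in x follows from that of the contour integral, and
  every x lies in such a smaller disc.\<close>

lemma hartogs_coeff_holomorphic:
  assumes a: "a > 0" and cont: "continuous_on (hartogs a) (\<lambda>(x, y). F x y)"
    and h1: "\<And>y. (\<lambda>x. F x y) holomorphic_on {x. (x, y) \<in> hartogs a}"
    and h2: "\<And>x. F x holomorphic_on {y. (x, y) \<in> hartogs a}"
  shows "(\<lambda>x. (deriv ^^ k) (F x) 0 / fact k) holomorphic_on ball 0 1"
proof -
  have "(\<lambda>x. (deriv ^^ k) (F x) 0 / fact k) holomorphic_on ball 0 \<rho>" if \<rho>: "0 < \<rho>" "\<rho> < 1" for \<rho>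
  proof -
    \<comment> \<open>Half the fibre radius at |x| = \<rho>, the narrowest fibre over the closed
      disc of radius \<rho>.\<close>
    define r where "r = hartogs_radius a (of_real \<rho>) / 2"
    have r: "r > 0" using \<rho> by (auto simp: r_def intro: hartogs_radius_pos)
    have in0: "(of_real \<rho>, of_real r) \<in> hartogs a"
      using \<rho> r by (auto simp: hartogs_iff r_def)
    have sub: "(x, y) \<in> hartogs a" if "cmod x \<le> \<rho>" "cmod y \<le> r" for x y
      by (rule hartogs_subset[OF in0 _ _ a]) (use that \<rho> r in auto)
    have "(\<lambda>x. contour_integral (circlepath 0 r) (\<lambda>u. F x u / u ^ Suc k)) holomorphic_on ball 0 \<rho>"
    proof (rule holomorphic_contour_integral_circlepath[OF \<rho>(1) r])
      show "continuous_on (cball 0 \<rho> \<times> sphere 0 r) (\<lambda>(x, y). F x y / y ^ Suc k)"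
        unfolding case_prod_beta' using r
        by (intro continuous_intros continuous_on_subset[OF cont[unfolded case_prod_beta']])
           (auto simp: sub)
      show "(\<lambda>x. F x y / y ^ Suc k) holomorphic_on ball 0 \<rho>" if "y \<in> sphere 0 r" for y
        using that r by (intro holomorphic_intros holomorphic_on_subset[OF h1]) (auto simp: sub)
    qed
    then have "(\<lambda>x. contour_integral (circlepath 0 r) (\<lambda>u. F x u / u ^ Suc k) / (2 * pi * \<i>)) holomorphic_on ball 0 \<rho>"
      by (intro holomorphic_intros) auto
    moreover have "(deriv ^^ k) (F x) 0 / fact k
        = contour_integral (circlepath 0 r) (\<lambda>u. F x u / u ^ Suc k) / (2 * pi * \<i>)" if "x \<in> ball 0 \<rho>" for x
    proof -
      have "F x holomorphic_on cball 0 r"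
        using that by (intro holomorphic_on_subset[OF h2]) (auto simp: sub)
      then show ?thesis
        by (intro higher_deriv_coeff_circlepath r)
           (auto intro: holomorphic_on_imp_continuous_on holomorphic_on_subset)
    qed
    ultimately show ?thesis by (subst holomorphic_cong[OF refl]) auto
  qed note * = this
  show ?thesis
    unfolding holomorphic_on_def
  proof
    fix x :: complex assume "x \<in> ball 0 1"
    then have x: "cmod x < (1 + cmod x) / 2" "(1 + cmod x) / 2 < 1" by auto
    then have "0 < (1 + cmod x) / 2" by (smt (verit) norm_ge_zero)
    show "(\<lambda>x. (deriv ^^ k) (F x) 0 / fact k) field_differentiable at x within ball 0 1"
      by (rule field_differentiable_at_within,
          rule holomorphic_on_imp_differentiable_at[OF *[OF \<open>0 < (1 + cmod x) / 2\<close> x(2)] open_ball])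
         (use x(1) in simp)
  qed
qed

lemma continuous_kernel_term:
  assumes "cmod z < 1"
  shows "continuous_on (hartogs a) (\<lambda>p. kernel_term a (z * cnj (fst p)) (w * cnj (snd p)) k)"
  unfolding kernel_term_def
  by (intro continuous_on_mult continuous_on_one_minus_powr continuous_intros norm_mult_cnj_less_1 assms)
     (auto simp: hartogs_def)

context
  fixes a :: real and z w :: complex
  assumes a: "a > 0" and zw: "(z, w) \<in> hartogs a"
begin

text \<open>The ratio |w| (1 - |z|^2) powr (- a / 2) < 1 from \<open>hartogs_ratio_le\<close>
  involves only the fixed point (z, w), so the bound is uniform up to the boundary in (x,
  y).\<close>

lemma hartogs_kernel_majorant:
  obtains M where "\<And>k. 0 \<le> M k" "summable M"
    "\<And>k x y. (x, y) \<in> hartogs a \<Longrightarrow> cmod (kernel_term a (z * cnj x) (w * cnj y) k) \<le> M k"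
proof -
  define \<rho> where "\<rho> = cmod w * (1 - (cmod z)\<^sup>2) powr (- (a / 2))"
  define C where "C = (1 - cmod z) powr (- (a + 2))"
  have z: "cmod z < 1" and \<rho>: "0 \<le> \<rho>" "\<rho> < 1"
    using hartogs_ratio_le(2,4)[OF a zw zw] by (auto simp: \<rho>_def)
  show ?thesis
  proof (rule that[of "\<lambda>k. kernel_coeff a k * \<rho> ^ k * C"])
    show "0 \<le> kernel_coeff a k * \<rho> ^ k * C" for k
      using kernel_coeff_pos[OF a, of k] \<rho> by (auto simp: C_def)
    show "summable (\<lambda>k. kernel_coeff a k * \<rho> ^ k * C)"
      using \<rho> by (intro summable_mult2 kernel_coeff_summable) auto
    fix k x y assume xy: "(x, y) \<in> hartogs a"
    note r = hartogs_ratio_le[OF a zw xy]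
    have "cmod (kernel_term a (z * cnj x) (w * cnj y) k)
       \<le> kernel_coeff a k * (cmod (w * cnj y) * (1 - cmod (z * cnj x)) powr (- a)) ^ k * (1 - cmod (z * cnj x)) powr (- (a + 2))"
      using r by (intro norm_kernel_term a) auto
    also have "\<dots> \<le> kernel_coeff a k * \<rho> ^ k * C"
      unfolding C_def using kernel_coeff_pos[OF a, of k] r(1,2,3) \<rho> a
      by (intro mult_mono mult_left_mono power_mono powr_mono2') (auto simp: \<rho>_def)
    finally show "cmod (kernel_term a (z * cnj x) (w * cnj y) k) \<le> kernel_coeff a k * \<rho> ^ k * C" .
  qed
qed

lemma hartogs_kernel_sums:
  assumes "(x, y) \<in> hartogs a"
  shows "kernel_term a (z * cnj x) (w * cnj y) sums hartogs_kernel a (z * cnj x) (w * cnj y)"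
  by (rule kernel_term_sums) (rule hartogs_parameters[OF a zw assms])+

end

section \<open>Termwise integration and the reproducing property\<close>

context
  fixes a :: real and F :: "complex \<Rightarrow> complex \<Rightarrow> complex" and z w :: complex
  assumes a: "a > 0" and zw: "(z, w) \<in> hartogs a"
    and cont: "continuous_on (hartogs a) (\<lambda>(x, y). F x y)"
    and h1: "\<And>y. (\<lambda>x. F x y) holomorphic_on {x. (x, y) \<in> hartogs a}"
    and h2: "\<And>x. F x holomorphic_on {y. (x, y) \<in> hartogs a}"
    and int: "integrable (lborel \<Otimes>\<^sub>M lborel) (\<lambda>p. indicator (hartogs a) p *\<^sub>R F (fst p) (snd p))"
begin

private lemma z1: "cmod z < 1"
  using zw by (auto simp: hartogs_def)

private definition T where
  "T k p = indicator (hartogs a) p *\<^sub>R F (fst p) (snd p) * kernel_term a (z * cnj (fst p)) (w * cnj (snd p)) k"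

private lemma T_bound:
  assumes "\<And>x y. (x, y) \<in> hartogs a \<Longrightarrow> cmod (kernel_term a (z * cnj x) (w * cnj y) k) \<le> B"
  shows "norm (T k p) \<le> B * norm (indicator (hartogs a) p *\<^sub>R F (fst p) (snd p))"
proof (cases "p \<in> hartogs a")
  case True
  then have "cmod (F (fst p) (snd p)) * cmod (kernel_term a (z * cnj (fst p)) (w * cnj (snd p)) k)
      \<le> cmod (F (fst p) (snd p)) * B"
    by (intro mult_left_mono assms) auto
  then show ?thesis using True by (simp add: T_def norm_mult mult.commute)
qed (simp add: T_def)

private lemma T_integrable: "integrable (lborel \<Otimes>\<^sub>M lborel) (T k)"
proof -
  obtain M where M: "\<And>k. 0 \<le> M k" "\<And>k x y. (x, y) \<in> hartogs a \<Longrightarrow> cmod (kernel_term a (z * cnj x) (w * cnj y) k) \<le> M k"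
    using hartogs_kernel_majorant[OF a zw] by metis
  have "(\<lambda>p. indicator (hartogs a) p *\<^sub>R kernel_term a (z * cnj (fst p)) (w * cnj (snd p)) k)
      \<in> borel_measurable borel"
    using open_hartogs[OF a] continuous_kernel_term[OF z1]
    by (intro borel_measurable_continuous_on_indicator) auto
  then have [measurable]: "(\<lambda>p. indicator (hartogs a) p *\<^sub>R kernel_term a (z * cnj (fst p)) (w * cnj (snd p)) k)
      \<in> borel_measurable (lborel \<Otimes>\<^sub>M lborel)"
    by (simp add: measurable_lborel1 lborel_prod)
  have [measurable]: "(\<lambda>p. indicator (hartogs a) p *\<^sub>R F (fst p) (snd p)) \<in> borel_measurable (lborel \<Otimes>\<^sub>M lborel)"
    using int by auto
  \<comment> \<open>The kernel term is known to be continuous only on the domain, so it receives an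
    indicator of its own; the product of the two indicators is again the indicator.\<close>
  have "(\<lambda>p. (indicator (hartogs a) p *\<^sub>R F (fst p) (snd p)) *
      (indicator (hartogs a) p *\<^sub>R kernel_term a (z * cnj (fst p)) (w * cnj (snd p)) k)) \<in> borel_measurable (lborel \<Otimes>\<^sub>M lborel)"
    by measurable
  also have "(\<lambda>p. (indicator (hartogs a) p *\<^sub>R F (fst p) (snd p)) *
      (indicator (hartogs a) p *\<^sub>R kernel_term a (z * cnj (fst p)) (w * cnj (snd p)) k)) = T k"
    by (auto simp: T_def indicator_def)
  finally have "T k \<in> borel_measurable (lborel \<Otimes>\<^sub>M lborel)" .
  then show ?thesis
    using T_bound[OF M(2)] M(1) int
    by (intro Bochner_Integration.integrable_bound[OF integrable_mult_right[OF integrable_norm[OF int]], of _ "M k"])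
       (auto intro!: always_eventually)
qed

text \<open>The integral over a fibre leaves the k-th coefficient f of F times the weight (1 -
  |x|^2) powr \<alpha>, up to pi / (k + 1); the integral over x is then the weighted reproducing
  formula for f. The two constants are those that \<open>kernel_coeff\<close> inverts.\<close>

private lemma T_integral:
  "(\<integral>p. T k p \<partial>(lborel \<Otimes>\<^sub>M lborel)) = (deriv ^^ k) (F z) 0 / fact k * w ^ k"
proof -
  define \<alpha> where "\<alpha> = a * (real k + 1)"
  have \<alpha>0: "\<alpha> > 0" unfolding \<alpha>_def using a by (intro mult_pos_pos) auto
  then have \<alpha>: "\<alpha> > -1" "\<alpha> > 0" by auto
  define f where "f x = (deriv ^^ k) (F x) 0 / fact k" for x
  have f: "f holomorphic_on ball 0 1"
    unfolding f_def by (rule hartogs_coeff_holomorphic[OF a cont h1 h2])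
  define P where "P x y = indicator (hartogs a) (x, y) *\<^sub>R (F x y * cnj y ^ k)" for x y
  have [measurable]: "cnj \<in> borel_measurable borel"
    by (intro borel_measurable_continuous_onI continuous_intros)
  have P: "integrable (lborel \<Otimes>\<^sub>M lborel) (\<lambda>(x, y). P x y)"
  proof (rule Bochner_Integration.integrable_bound[OF int])
    have [measurable]: "(\<lambda>p. indicator (hartogs a) p *\<^sub>R F (fst p) (snd p)) \<in> borel_measurable (lborel \<Otimes>\<^sub>M lborel)"
      using int by auto
    have "(\<lambda>p. (indicator (hartogs a) p *\<^sub>R F (fst p) (snd p)) * cnj (snd p) ^ k) \<in> borel_measurable (lborel \<Otimes>\<^sub>M lborel)"
      by measurable
    then show "(\<lambda>(x, y). P x y) \<in> borel_measurable (lborel \<Otimes>\<^sub>M lborel)"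
      by (simp add: P_def case_prod_beta')
    have "norm (P x y) \<le> norm (indicator (hartogs a) (x, y) *\<^sub>R F x y)" for x y
    proof (cases "(x, y) \<in> hartogs a")
      case True
      then have "cmod y \<le> 1" using hartogs_norm_less_1(2) a by fastforce
      then show ?thesis using True
        by (auto simp: P_def norm_mult norm_power intro!: mult_right_le_one_le power_le_one)
    qed (simp add: P_def)
    then show "AE p in lborel \<Otimes>\<^sub>M lborel. norm (case p of (x, y) \<Rightarrow> P x y) \<le> norm (indicator (hartogs a) p *\<^sub>R F (fst p) (snd p))"
      by (auto simp: case_prod_beta')
  qed
  \<comment> \<open>Fubini provides integrable fibres only for almost every x, hence this hypothesis
    and the almost-everywhere identity \<open>ae\<close>.\<close>
  have inner: "(\<integral>y. P x y \<partial>lborel) = indicator (ball 0 1) x *\<^sub>R (f x * of_real ((1 - (cmod x)\<^sup>2) powr \<alpha>)) * (pi / (real k + 1))"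
    if "integrable lborel (P x)" for x
  proof (cases "x \<in> ball 0 1")
    case True
    then have x1: "cmod x < 1" by simp
    have ind: "indicator (hartogs a) (x, y) = (indicator (ball 0 (hartogs_radius a x)) y :: real)" for y
      using True by (auto simp: indicator_def hartogs_iff)
    have Peq: "P x = (\<lambda>y. indicator (ball 0 (hartogs_radius a x)) y *\<^sub>R (F x y * cnj y ^ k * of_real ((\<lambda>_. 1) (cmod y))))"
      by (simp add: P_def fun_eq_iff ind)
    have "F x holomorphic_on ball 0 (hartogs_radius a x)"
      using True by (intro holomorphic_on_subset[OF h2]) (auto simp: hartogs_iff)
    from integral_disc_angular[OF this that[unfolded Peq]]
    have "(\<integral>y. P x y \<partial>lborel) = f x * of_real (\<integral>y. indicator (ball 0 (hartogs_radius a x)) (y::complex) * cmod y ^ (2 * k) \<partial>lborel)"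
      unfolding Peq f_def by simp
    also have "(\<integral>y. indicator (ball 0 (hartogs_radius a x)) (y::complex) * cmod y ^ (2 * k) \<partial>lborel)
        = pi * ((1 - (cmod x)\<^sup>2) powr a) ^ Suc k / Suc k"
      unfolding hartogs_radius_def by (rule moment_disc) simp
    \<comment> \<open>The area element raises the exponent from k to k + 1, which is why \<alpha> is
      a (k + 1) and not a k.\<close>
    also have "((1 - (cmod x)\<^sup>2) powr a) ^ Suc k = (1 - (cmod x)\<^sup>2) powr \<alpha>"
    proof -
      have "1 - (cmod x)\<^sup>2 > 0" using square_norm_less_1[OF x1] by simp
      then show ?thesis by (simp add: \<alpha>_def powr_powr powr_realpow[symmetric] add.commute del: power_Suc)
    qed
    finally show ?thesis using True by (simp add: add.commute)
  next
    case False
    then have "P x = (\<lambda>_. 0)" by (auto simp: P_def fun_eq_iff hartogs_iff)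
    then show ?thesis using False by simp
  qed
  have ae: "AE x in lborel. (\<integral>y. P x y \<partial>lborel) = indicator (ball 0 1) x *\<^sub>R (f x * of_real ((1 - (cmod x)\<^sup>2) powr \<alpha>)) * (pi / (real k + 1))"
    using lborel_pair.AE_integrable_fst'[OF P] by (auto elim!: eventually_mono simp: inner)
  have mf: "(\<lambda>x. indicator (ball 0 1) x *\<^sub>R (f x * of_real ((1 - (cmod x)\<^sup>2) powr \<alpha>))) \<in> borel_measurable lborel"
  proof -
    have "continuous_on (ball 0 1) (\<lambda>x. f x * of_real ((1 - (cmod x)\<^sup>2) powr \<alpha>))"
      using holomorphic_on_imp_continuous_on[OF f]
      by (intro continuous_intros) (use square_norm_less_1 in force)+
    then show ?thesis by (simp add: borel_measurable_continuous_on_indicator)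
  qed
  have "integrable lborel (\<lambda>x. indicator (ball 0 1) x *\<^sub>R (f x * of_real ((1 - (cmod x)\<^sup>2) powr \<alpha>)) * (pi / (real k + 1)))"
  proof (subst integrable_cong_AE[OF _ _ ae, symmetric])
    show "integrable lborel (\<lambda>x. \<integral>y. P x y \<partial>lborel)"
      using lborel_pair.integrable_fst'[OF P] by simp
    then show "(\<lambda>x. \<integral>y. P x y \<partial>lborel) \<in> borel_measurable lborel" by auto
  qed (intro borel_measurable_times mf borel_measurable_const)
  from integrable_mult_left[OF this, of "complex_of_real ((real k + 1) / pi)"]
  have "integrable lborel (\<lambda>x. indicator (ball 0 1) x *\<^sub>R (f x * of_real ((1 - (cmod x)\<^sup>2) powr \<alpha>))
      * (pi / (real k + 1)) * complex_of_real ((real k + 1) / pi))" by simp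
  moreover have "q * (pi / (real k + 1)) * complex_of_real ((real k + 1) / pi) = q" for q :: complex
  proof -
    have "complex_of_real (pi / (real k + 1)) * complex_of_real ((real k + 1) / pi) = 1"
      unfolding of_real_mult[symmetric] by simp
    then show ?thesis by (metis mult.assoc mult.right_neutral)
  qed
  ultimately have intf: "integrable lborel (\<lambda>x. indicator (ball 0 1) x *\<^sub>R (f x * of_real ((1 - (cmod x)\<^sup>2) powr \<alpha>)))"
    by (simp only:)
  define S where "S x = (1 - z * cnj x) powr of_real (- (\<alpha> + 2))" for x
  have Tx: "T k (x, y) = (of_real (kernel_coeff a k) * w ^ k * S x) * P x y" for x y
    by (simp add: T_def P_def S_def \<alpha>_def kernel_term_def power_mult_distrib mult_ac)
  have "(\<integral>p. T k p \<partial>(lborel \<Otimes>\<^sub>M lborel)) = (\<integral>x. (\<integral>y. T k (x, y) \<partial>lborel) \<partial>lborel)"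
    by (rule lborel_pair.integral_fst'[OF T_integrable, symmetric])
  also have "\<dots> = (\<integral>x. (of_real (kernel_coeff a k) * w ^ k * S x) * (\<integral>y. P x y \<partial>lborel) \<partial>lborel)"
    by (simp add: Tx)
  also have "\<dots> = (\<integral>x. (of_real (kernel_coeff a k) * w ^ k * (pi / (real k + 1))) *
       (indicator (ball 0 1) x *\<^sub>R (f x * of_real ((1 - (cmod x)\<^sup>2) powr \<alpha>) * S x)) \<partial>lborel)"
  proof (rule integral_cong_AE)
    have [measurable]: "(\<lambda>x. \<integral>y. P x y \<partial>lborel) \<in> borel_measurable lborel"
      using lborel_pair.integrable_fst'[OF P] by auto
    have "continuous_on (ball 0 1) S"
      unfolding S_def by (intro continuous_on_one_minus_powr continuous_intros norm_mult_cnj_less_1 z1) auto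
    then have mS: "(\<lambda>x. indicator (ball 0 1) x *\<^sub>R S x) \<in> borel_measurable lborel"
      by (simp add: borel_measurable_continuous_on_indicator)
    have "(\<lambda>x. \<integral>y. T k (x, y) \<partial>lborel) \<in> borel_measurable lborel"
      using lborel_pair.integrable_fst'[OF T_integrable[of k]] by auto
    then show "(\<lambda>x. (of_real (kernel_coeff a k) * w ^ k * S x) * (\<integral>y. P x y \<partial>lborel)) \<in> borel_measurable lborel"
      by (simp add: Tx)
    have "(\<lambda>x. (of_real (kernel_coeff a k) * w ^ k * (pi / (real k + 1))) *
       ((indicator (ball 0 1) x *\<^sub>R (f x * of_real ((1 - (cmod x)\<^sup>2) powr \<alpha>))) * (indicator (ball 0 1) x *\<^sub>R S x))) \<in> borel_measurable lborel"
      by (intro borel_measurable_times mf mS) auto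
    also have "(\<lambda>x. (of_real (kernel_coeff a k) * w ^ k * (pi / (real k + 1))) *
       ((indicator (ball 0 1) x *\<^sub>R (f x * of_real ((1 - (cmod x)\<^sup>2) powr \<alpha>))) * (indicator (ball 0 1) x *\<^sub>R S x)))
       = (\<lambda>x. (of_real (kernel_coeff a k) * w ^ k * (pi / (real k + 1))) *
       (indicator (ball 0 1) x *\<^sub>R (f x * of_real ((1 - (cmod x)\<^sup>2) powr \<alpha>) * S x)))"
      by (auto simp: indicator_def)
    finally show "\<dots> \<in> borel_measurable lborel" .
    show "AE x in lborel. (of_real (kernel_coeff a k) * w ^ k * S x) * (\<integral>y. P x y \<partial>lborel)
       = (of_real (kernel_coeff a k) * w ^ k * (pi / (real k + 1))) *
       (indicator (ball 0 1) x *\<^sub>R (f x * of_real ((1 - (cmod x)\<^sup>2) powr \<alpha>) * S x))"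
      using ae by eventually_elim (simp add: mult_ac)
  qed
  also have "\<dots> = (of_real (kernel_coeff a k) * w ^ k * (pi / (real k + 1))) * (pi / (\<alpha> + 1) * f z)"
    unfolding S_def by (subst integral_mult_right_zero, subst weighted_bergman_disc[OF \<alpha>(1) f z1 intf]) simp
  also have "\<dots> = f z * w ^ k * of_real (kernel_coeff a k * (pi / (real k + 1)) * (pi / (\<alpha> + 1)))"
    by (simp add: mult_ac)
  also have "kernel_coeff a k * (pi / (real k + 1)) * (pi / (\<alpha> + 1)) = 1"
  proof -
    have "c * d / pi\<^sup>2 * (pi / c) * (pi / d) = 1" if "c > 0" "d > 0" for c d :: real
      using that by (simp add: power2_eq_square)
    from this[of "real k + 1" "\<alpha> + 1"] \<alpha> show ?thesis by (simp add: kernel_coeff_def \<alpha>_def)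
  qed
  finally show ?thesis by (simp add: f_def)
qed

text \<open>The k-th term returns the k-th Taylor term of y \<mapsto> F z y at w, centred at 0; the
  fibre over z is a disc, so these sum to F z w. Dominating the terms by M k times |F| justifies the
  interchange.\<close>

lemma hartogs_reproducing:
  "(\<integral>p. indicator (hartogs a) p *\<^sub>R (F (fst p) (snd p) * hartogs_kernel a (z * cnj (fst p)) (w * cnj (snd p)))
     \<partial>(lborel \<Otimes>\<^sub>M lborel)) = F z w"
proof -
  obtain M where M: "\<And>k. 0 \<le> M k" "summable M"
    "\<And>k x y. (x, y) \<in> hartogs a \<Longrightarrow> cmod (kernel_term a (z * cnj x) (w * cnj y) k) \<le> M k"
    using hartogs_kernel_majorant[OF a zw] by metis
  let ?q = "\<lambda>p. norm (indicator (hartogs a) p *\<^sub>R F (fst p) (snd p))"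
  have nT: "norm (T k p) \<le> M k * ?q p" for k p by (rule T_bound[OF M(3)])
  have "(\<lambda>k. \<integral>p. T k p \<partial>(lborel \<Otimes>\<^sub>M lborel)) sums (\<integral>p. (suminf (\<lambda>k. T k p)) \<partial>(lborel \<Otimes>\<^sub>M lborel))"
  proof (rule sums_integral[OF T_integrable])
    show "AE p in lborel \<Otimes>\<^sub>M lborel. summable (\<lambda>k. norm (T k p))"
    proof (intro always_eventually allI)
      show "summable (\<lambda>k. norm (T k p))" for p
        by (rule summable_comparison_test'[OF summable_mult2[OF M(2), of "?q p"], of 0])
           (simp only: norm_ge_zero real_norm_def abs_of_nonneg nT)
    qed
    show "summable (\<lambda>k. \<integral>p. norm (T k p) \<partial>(lborel \<Otimes>\<^sub>M lborel))"
    proof (rule summable_comparison_test'[OF summable_mult2[OF M(2)], of 0])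
      fix k :: nat
      have "(\<integral>p. norm (T k p) \<partial>(lborel \<Otimes>\<^sub>M lborel)) \<le> (\<integral>p. M k * ?q p \<partial>(lborel \<Otimes>\<^sub>M lborel))"
        using nT by (intro integral_mono integrable_norm T_integrable integrable_mult_right int)
      then show "norm (\<integral>p. norm (T k p) \<partial>(lborel \<Otimes>\<^sub>M lborel)) \<le> M k * (\<integral>p. ?q p \<partial>(lborel \<Otimes>\<^sub>M lborel))"
        by simp
    qed
  qed
  moreover have "(suminf (\<lambda>k. T k p)) = indicator (hartogs a) p *\<^sub>R
      (F (fst p) (snd p) * hartogs_kernel a (z * cnj (fst p)) (w * cnj (snd p)))" for p
  proof (cases "p \<in> hartogs a")
    case True
    from sums_unique[OF sums_mult[OF hartogs_kernel_sums[OF a zw], of "fst p" "snd p" "F (fst p) (snd p)"]] True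
    show ?thesis by (simp add: T_def)
  qed (simp add: T_def)
  moreover have "(\<lambda>k. (deriv ^^ k) (F z) 0 / fact k * (w - 0) ^ k) sums F z w"
    using zw by (intro holomorphic_power_series holomorphic_on_subset[OF h2]) (auto simp: hartogs_iff)
  ultimately show ?thesis by (simp add: T_integral sums_unique2)
qed

end

section \<open>Functions on pairs and on the product space\<close>

text \<open>Restriction to \<open>{..<2}\<close> supplies the value \<open>undefined\<close> that
  points of \<open>Cn 2\<close> must have elsewhere.\<close>

definition E2 :: "complex \<times> complex \<Rightarrow> nat \<Rightarrow> complex" where
  "E2 p = (\<lambda>i\<in>{..<2}. if i = 0 then fst p else snd p)"

definition P2 :: "(nat \<Rightarrow> complex) \<Rightarrow> complex \<times> complex" where
  "P2 f = (f 0, f 1)"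

lemma E2_simps [simp]: "E2 p 0 = fst p" "E2 p 1 = snd p" "E2 p (Suc 0) = snd p" "P2 (E2 p) = p"
  by (simp_all add: E2_def P2_def)

lemma E2_in_Cn [simp]: "E2 p \<in> Cn 2"
  by (simp add: E2_def Cn_def)

lemma E2_P2:
  assumes f: "f \<in> Cn 2"
  shows "E2 (P2 f) = f"
proof (rule ext)
  fix i :: nat
  consider "i = 0" | "i = 1" | "\<not> i < 2" by linarith
  then show "E2 (P2 f) i = f i"
    using f by cases (auto simp: E2_def P2_def Cn_def PiE_iff extensional_def)
qed

text \<open>Images become relative preimages under the continuous map \<open>P2\<close>, which makes
  openness in \<open>Cn 2\<close> immediate.\<close>

lemma E2_image: "E2 ` S = Cn 2 \<inter> P2 -` S"
proof (intro equalityI subsetI)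
  fix f assume "f \<in> Cn 2 \<inter> P2 -` S"
  then show "f \<in> E2 ` S" by (intro image_eqI[of _ _ "P2 f"]) (simp_all add: E2_P2)
qed auto

lemma inj_E2: "E2 p = E2 q \<longleftrightarrow> p = q"
  by (metis E2_simps(4))

lemma continuous_E2: "continuous_on S E2"
proof (rule continuous_on_coordinatewise_then_product)
  fix i
  show "continuous_on S (\<lambda>p. E2 p i)"
    by (cases "i = 0"; cases "i = 1") (auto simp: E2_def intro: continuous_intros)
qed

lemma continuous_P2: "continuous_on S P2"
proof -
  have "continuous_on UNIV P2"
    unfolding P2_def by (intro continuous_on_Pair continuous_on_product_coordinates)
  then show ?thesis by (rule continuous_on_subset) simp
qed

lemma norm_Cn_E2: "norm_Cn 2 (\<lambda>i. E2 q i - E2 p i) = norm (q - p)"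
proof -
  have "{..<2} = {0, 1::nat}" by auto
  then show ?thesis by (simp add: norm_Cn_def L2_set_def norm_prod_def)
qed

lemma filterlim_E2: "filterlim E2 (at (E2 p) within E2 ` U) (at p within U)"
  unfolding filterlim_at
proof
  show "\<forall>\<^sub>F q in at p within U. E2 q \<in> E2 ` U \<and> E2 q \<noteq> E2 p"
    by (auto simp: eventually_at_filter inj_E2)
  show "(E2 \<longlongrightarrow> E2 p) (at p within U)"
    using continuous_E2[of UNIV] unfolding continuous_on_def
    by (metis UNIV_I subset_UNIV tendsto_within_subset)
qed

lemma filterlim_P2: "filterlim P2 (at p within U) (at (E2 p) within E2 ` U)"
  unfolding filterlim_at
proof
  show "\<forall>\<^sub>F q in at (E2 p) within E2 ` U. P2 q \<in> U \<and> P2 q \<noteq> p"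
    unfolding eventually_at_filter by (intro always_eventually) auto
  show "(P2 \<longlongrightarrow> p) (at (E2 p) within E2 ` U)"
    using continuous_P2[of UNIV] E2_simps(4)[of p] unfolding continuous_on_def
    by (metis UNIV_I subset_UNIV tendsto_within_subset)
qed

text \<open>\<open>E2\<close> and \<open>P2\<close> are mutually inverse between U and its image and
  respect punctured neighbourhoods, so a limit can be pulled back along either.\<close>

lemma tendsto_E2_iff:
  "(g \<longlongrightarrow> l) (at (E2 p) within E2 ` U) \<longleftrightarrow> ((\<lambda>q. g (E2 q)) \<longlongrightarrow> l) (at p within U)"
proof
  assume "(g \<longlongrightarrow> l) (at (E2 p) within E2 ` U)"
  then show "((\<lambda>q. g (E2 q)) \<longlongrightarrow> l) (at p within U)"
    by (rule filterlim_compose[OF _ filterlim_E2])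
next
  assume "((\<lambda>q. g (E2 q)) \<longlongrightarrow> l) (at p within U)"
  then have "((\<lambda>v. g (E2 (P2 v))) \<longlongrightarrow> l) (at (E2 p) within E2 ` U)"
    by (rule filterlim_compose[OF _ filterlim_P2])
  then show "(g \<longlongrightarrow> l) (at (E2 p) within E2 ` U)"
    by (rule Lim_transform_eventually) (auto simp: eventually_at_filter intro!: always_eventually)
qed

text \<open>Frechet differentiability with a complex linear derivative;
  \<open>has_derivative\<close> by itself asks for real linearity only.\<close>

definition cdiff2 :: "(complex \<times> complex \<Rightarrow> complex) \<Rightarrow> complex \<times> complex \<Rightarrow> bool" where
  "cdiff2 F p \<longleftrightarrow> (\<exists>a b. (F has_derivative (\<lambda>h. a * fst h + b * snd h)) (at p))"

text \<open>Both sides are the same difference quotient, because the norm on pairs is the Euclidean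
  one; openness of U lets limits within U serve for the derivative at p.\<close>

lemma holomorphic_Cn_E2:
  assumes "open U"
  shows "holomorphic_Cn 2 (E2 ` U) f \<longleftrightarrow> (\<forall>p\<in>U. cdiff2 (\<lambda>q. f (E2 q)) p)"
proof -
  have "(\<exists>a :: nat \<Rightarrow> complex. ((\<lambda>w. (f w - f (E2 p) - (\<Sum>i<2. a i * (w i - E2 p i)))
               / of_real (norm_Cn 2 (\<lambda>i. w i - E2 p i))) \<longlongrightarrow> 0) (at (E2 p) within E2 ` U))
     \<longleftrightarrow> cdiff2 (\<lambda>q. f (E2 q)) p" if "p \<in> U" for p
  proof -
    have bl: "bounded_linear (\<lambda>h::complex\<times>complex. a * fst h + b * snd h)" for a b
      by (intro bounded_linear_intros)
    have eq: "(1 / norm (q - p)) *\<^sub>R (f (E2 q) - (f (E2 p) + (a * fst (q - p) + b * snd (q - p))))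
       = (f (E2 q) - f (E2 p) - (a * (fst q - fst p) + b * (snd q - snd p))) / of_real (norm (q - p))" for q a b
      by (simp add: scaleR_conv_of_real field_simps)
    have "cdiff2 (\<lambda>q. f (E2 q)) p \<longleftrightarrow> (\<exists>a b. ((\<lambda>q. (f (E2 q) - f (E2 p) - (a * (fst q - fst p) + b * (snd q - snd p)))
        / of_real (norm (q - p))) \<longlongrightarrow> 0) (at p within U))"
      unfolding cdiff2_def has_derivative_within at_within_open[OF that assms, symmetric] using bl by (simp only: eq simp_thms)
    also have "\<dots> \<longleftrightarrow> (\<exists>c::nat \<Rightarrow> complex. ((\<lambda>q. (f (E2 q) - f (E2 p) - (c 0 * (fst q - fst p) + c 1 * (snd q - snd p)))
        / of_real (norm (q - p))) \<longlongrightarrow> 0) (at p within U))"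
    proof safe
      fix a b assume *: "((\<lambda>q. (f (E2 q) - f (E2 p) - (a * (fst q - fst p) + b * (snd q - snd p)))
        / of_real (norm (q - p))) \<longlongrightarrow> 0) (at p within U)"
      show "\<exists>c::nat \<Rightarrow> complex. ((\<lambda>q. (f (E2 q) - f (E2 p) - (c 0 * (fst q - fst p) + c 1 * (snd q - snd p)))
        / of_real (norm (q - p))) \<longlongrightarrow> 0) (at p within U)"
        by (rule exI[of _ "\<lambda>i. if i = 0 then a else b"]) (use * in simp)
    qed blast
    finally show ?thesis by (simp add: tendsto_E2_iff norm_Cn_E2) (simp add: numeral_2_eq_2)
  qed
  then show ?thesis unfolding holomorphic_Cn_def by auto
qed

lemma cdiff2_slices:
  assumes "cdiff2 F (x, y)"
  shows "(\<lambda>x. F (x, y)) field_differentiable at x" "(\<lambda>y. F (x, y)) field_differentiable at y"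
    "isCont F (x, y)"
proof -
  obtain a b where F: "(F has_derivative (\<lambda>h. a * fst h + b * snd h)) (at (x, y))"
    using assms unfolding cdiff2_def by blast
  have "((\<lambda>x. F (x, y)) has_derivative (\<lambda>h. a * fst (h, 0::complex) + b * snd (h, 0::complex))) (at x)"
    by (rule has_derivative_compose[of "\<lambda>x. (x, y)" "\<lambda>h. (h, 0)", OF _ F]) (auto intro!: derivative_eq_intros)
  then show "(\<lambda>x. F (x, y)) field_differentiable at x"
    by (auto simp: field_differentiable_def has_field_derivative_def)
  have "((\<lambda>y. F (x, y)) has_derivative (\<lambda>h. a * fst (0::complex, h) + b * snd (0::complex, h))) (at y)"
    by (rule has_derivative_compose[of "\<lambda>y. (x, y)" "\<lambda>h. (0, h)", OF _ F]) (auto intro!: derivative_eq_intros)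
  then show "(\<lambda>y. F (x, y)) field_differentiable at y"
    by (auto simp: field_differentiable_def has_field_derivative_def)
  show "isCont F (x, y)" using F by (rule has_derivative_continuous)
qed

lemma cdiff2_fst: "cdiff2 (\<lambda>p. fst p * c) p" and cdiff2_snd: "cdiff2 (\<lambda>p. snd p * c) p"
proof -
  have "((\<lambda>p. fst p * c) has_derivative (\<lambda>h. c * fst h + 0 * snd h)) (at p)"
    by (auto intro!: derivative_eq_intros simp: mult.commute)
  then show "cdiff2 (\<lambda>p. fst p * c) p" unfolding cdiff2_def by blast
  have "((\<lambda>p. snd p * c) has_derivative (\<lambda>h. 0 * fst h + c * snd h)) (at p)"
    by (auto intro!: derivative_eq_intros simp: mult.commute)
  then show "cdiff2 (\<lambda>p. snd p * c) p" unfolding cdiff2_def by blast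
qed

lemma cdiff2_mult:
  assumes "cdiff2 F p" "cdiff2 G p"
  shows "cdiff2 (\<lambda>q. F q * G q) p"
proof -
  obtain a b c d where "(F has_derivative (\<lambda>h. a * fst h + b * snd h)) (at p)"
    "(G has_derivative (\<lambda>h. c * fst h + d * snd h)) (at p)"
    using assms unfolding cdiff2_def by blast
  from has_derivative_mult[OF this]
  have "((\<lambda>q. F q * G q) has_derivative (\<lambda>h. (F p * c + a * G p) * fst h + (F p * d + b * G p) * snd h)) (at p)"
    by (simp add: algebra_simps)
  then show ?thesis unfolding cdiff2_def by blast
qed

lemma cdiff2_compose:
  assumes "cdiff2 F p" "g field_differentiable at (F p)"
  shows "cdiff2 (\<lambda>q. g (F q)) p"
proof -
  obtain a b where "(F has_derivative (\<lambda>h. a * fst h + b * snd h)) (at p)"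
    using assms unfolding cdiff2_def by blast
  moreover obtain d where "(g has_derivative (\<lambda>h. d * h)) (at (F p))"
    using assms by (auto simp: field_differentiable_def has_field_derivative_def)
  ultimately have "((\<lambda>q. g (F q)) has_derivative (\<lambda>h. d * (a * fst h + b * snd h))) (at p)"
    by (rule has_derivative_compose)
  then have "((\<lambda>q. g (F q)) has_derivative (\<lambda>h. (d * a) * fst h + (d * b) * snd h)) (at p)"
    by (simp add: algebra_simps)
  then show ?thesis unfolding cdiff2_def by blast
qed

section \<open>Transfer of integrals between pairs and \<open>Cn 2\<close>\<close>

lemma measurable_E2: "E2 \<in> lborel \<Otimes>\<^sub>M lborel \<rightarrow>\<^sub>M Pi\<^sub>M {..<2} (\<lambda>_. lborel)"
  unfolding E2_def by (intro measurable_restrict) simp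

lemma measurable_P2: "P2 \<in> Pi\<^sub>M {..<2} (\<lambda>_. lborel) \<rightarrow>\<^sub>M lborel \<Otimes>\<^sub>M lborel"
  unfolding P2_def by (intro measurable_Pair measurable_component_singleton) auto

lemma lebesgue_Cn_2: "lebesgue_Cn 2 = distr (lborel \<Otimes>\<^sub>M lborel) (Pi\<^sub>M {..<2} (\<lambda>_. lborel)) E2"
proof -
  interpret product_sigma_finite "\<lambda>_::nat. lborel :: complex measure" ..
  show ?thesis unfolding lebesgue_Cn_def
  proof (rule PiM_eqI[symmetric])
    fix A :: "nat \<Rightarrow> complex set" assume A: "\<And>i. i \<in> {..<2} \<Longrightarrow> A i \<in> sets lborel"
    then have A01: "A 0 \<in> sets lborel" "A 1 \<in> sets lborel" by auto
    have two: "{..<2} = {0, 1::nat}" by auto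
    have "E2 p \<in> Pi\<^sub>E {..<2} A \<longleftrightarrow> p \<in> A 0 \<times> A 1" for p
    proof -
      have "E2 p \<in> extensional {..<2}" by (simp add: E2_def)
      then have "E2 p \<in> Pi\<^sub>E {..<2} A \<longleftrightarrow> (\<forall>i\<in>{0, 1}. E2 p i \<in> A i)"
        unfolding PiE_iff two by blast
      also have "\<dots> \<longleftrightarrow> p \<in> A 0 \<times> A 1" by (simp add: mem_Times_iff)
      finally show ?thesis .
    qed
    then have "E2 -` Pi\<^sub>E {..<2} A \<inter> space (lborel \<Otimes>\<^sub>M lborel) = A 0 \<times> A 1"
      by (simp add: vimage_def space_pair_measure)
    moreover have "Pi\<^sub>E {..<2} A \<in> sets (Pi\<^sub>M {..<2} (\<lambda>_. lborel))"
      using A by (intro sets_PiM_I_finite) auto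
    ultimately show "emeasure (distr (lborel \<Otimes>\<^sub>M lborel) (Pi\<^sub>M {..<2} (\<lambda>_. lborel)) E2) (Pi\<^sub>E {..<2} A)
        = (\<Prod>i\<in>{..<2}. emeasure lborel (A i))"
      using A01 by (subst emeasure_distr[OF measurable_E2])
        (auto simp: lborel.emeasure_pair_measure_Times two)
  qed auto
qed

lemma integral_lebesgue_Cn_2:
  fixes f :: "(nat \<Rightarrow> complex) \<Rightarrow> 'b::{banach, second_countable_topology}"
  shows "integrable (lebesgue_Cn 2) f \<longleftrightarrow> integrable (lborel \<Otimes>\<^sub>M lborel) (\<lambda>p. f (E2 p))" (is "?l \<longleftrightarrow> ?r")
    and "integrable (lborel \<Otimes>\<^sub>M lborel) (\<lambda>p. f (E2 p)) \<Longrightarrow>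
      (\<integral>v. f v \<partial>lebesgue_Cn 2) = (\<integral>p. f (E2 p) \<partial>(lborel \<Otimes>\<^sub>M lborel))"
proof -
  \<comment> \<open>Measurability of f is recovered through \<open>P2\<close>, which undoes
    \<open>E2\<close> on the space of the product measure; so the equivalence holds for arbitrary
    f.\<close>
  have m: "f \<in> borel_measurable (Pi\<^sub>M {..<2} (\<lambda>_. lborel))" if ?r
  proof -
    have "(\<lambda>v. f (E2 (P2 v))) \<in> borel_measurable (Pi\<^sub>M {..<2} (\<lambda>_. lborel))"
      using measurable_compose[OF measurable_P2 borel_measurable_integrable[OF that]] .
    also have "?this \<longleftrightarrow> ?thesis"
      by (intro measurable_cong) (auto simp: space_PiM E2_P2 Cn_def)
    finally show ?thesis .
  qed
  show "?l \<longleftrightarrow> ?r"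
    unfolding lebesgue_Cn_2 using integrable_distr[OF measurable_E2, of f] integrable_distr_eq[OF measurable_E2 m] by auto
  show "(\<integral>v. f v \<partial>lebesgue_Cn 2) = (\<integral>p. f (E2 p) \<partial>(lborel \<Otimes>\<^sub>M lborel))" if ?r
    unfolding lebesgue_Cn_2 by (rule integral_distr[OF measurable_E2 m[OF that]])
qed

section \<open>The Bergman kernel and the quadrature formula\<close>

definition hartogs_Cn :: "real \<Rightarrow> (nat \<Rightarrow> complex) set" where
  "hartogs_Cn a = E2 ` hartogs a"

definition hartogs_Cn_kernel :: "real \<Rightarrow> (nat \<Rightarrow> complex) \<Rightarrow> (nat \<Rightarrow> complex) \<Rightarrow> complex" where
  "hartogs_Cn_kernel a z w = hartogs_kernel a (z 0 * cnj (w 0)) (z 1 * cnj (w 1))"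

lemma norm_hartogs_le:
  assumes "p \<in> hartogs a" "a > 0"
  shows "norm p \<le> 2"
  using hartogs_norm_less_1[of "fst p" "snd p" a] norm_Pair_le[of "fst p" "snd p"] assms by simp

lemma domain_hartogs:
  assumes "a > 0"
  shows "domain_Cn 2 (hartogs_Cn a)"
  unfolding domain_Cn_def
proof (intro conjI)
  show "openin (top_of_set (Cn 2)) (hartogs_Cn a)"
    unfolding hartogs_Cn_def E2_image
    by (rule continuous_openin_preimage_gen[OF continuous_P2 open_hartogs[OF assms]])
  have 0: "(0, 0) \<in> hartogs a" by (simp add: hartogs_def)
  then show "hartogs_Cn a \<noteq> {}" by (auto simp: hartogs_Cn_def)
  \<comment> \<open>Star-shapedness is used because the domain is not convex for large
    \<open>a\<close>.\<close>
  have "starlike (hartogs a)"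
    unfolding starlike_def
  proof (intro bexI[OF _ 0] ballI subsetI)
    fix p q assume p: "p \<in> hartogs a" and "q \<in> closed_segment (0, 0) p"
    then obtain u where u: "0 \<le> u" "u \<le> 1" "q = u *\<^sub>R p"
      by (auto simp: closed_segment_def zero_prod_def[symmetric])
    have "(u *\<^sub>R fst p, u *\<^sub>R snd p) \<in> hartogs a"
      by (rule hartogs_subset[of "fst p" "snd p"]) (use p u assms in \<open>auto intro: mult_left_le_one_le\<close>)
    then show "q \<in> hartogs a" by (simp add: u scaleR_prod_def)
  qed
  then have "connected (hartogs a)" by (rule starlike_imp_connected)
  then show "connected (hartogs_Cn a)"
    unfolding hartogs_Cn_def by (rule connected_continuous_image[OF continuous_E2])
qed

lemma bounded_hartogs:
  assumes "a > 0"
  shows "bounded_Cn 2 (hartogs_Cn a)"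
proof -
  have "norm_Cn 2 (E2 p) = norm p" for p
  proof -
    have "{..<2} = {0, 1::nat}" by auto
    then show ?thesis by (simp add: norm_Cn_def L2_set_def norm_prod_def)
  qed
  then show ?thesis
    unfolding bounded_Cn_def hartogs_Cn_def using norm_hartogs_le[OF _ assms]
    by (intro exI[of _ 2] ballI) auto
qed

lemma set_integral_hartogs_Cn:
  fixes f :: "(nat \<Rightarrow> complex) \<Rightarrow> 'b::{banach, second_countable_topology}"
  shows "set_integrable (lebesgue_Cn 2) (hartogs_Cn a) f \<longleftrightarrow>
      integrable (lborel \<Otimes>\<^sub>M lborel) (\<lambda>p. indicator (hartogs a) p *\<^sub>R f (E2 p))"
    and "set_integrable (lebesgue_Cn 2) (hartogs_Cn a) f \<Longrightarrow>
      (LINT v:hartogs_Cn a|lebesgue_Cn 2. f v)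
       = (\<integral>p. indicator (hartogs a) p *\<^sub>R f (E2 p) \<partial>(lborel \<Otimes>\<^sub>M lborel))"
proof -
  have "indicator (hartogs_Cn a) (E2 p) = (indicator (hartogs a) p :: real)" for p
    by (auto simp: hartogs_Cn_def indicator_def inj_E2)
  then show "set_integrable (lebesgue_Cn 2) (hartogs_Cn a) f \<longleftrightarrow>
      integrable (lborel \<Otimes>\<^sub>M lborel) (\<lambda>p. indicator (hartogs a) p *\<^sub>R f (E2 p))"
    and "set_integrable (lebesgue_Cn 2) (hartogs_Cn a) f \<Longrightarrow>
      (LINT v:hartogs_Cn a|lebesgue_Cn 2. f v)
       = (\<integral>p. indicator (hartogs a) p *\<^sub>R f (E2 p) \<partial>(lborel \<Otimes>\<^sub>M lborel))"
    unfolding set_integrable_def set_lebesgue_integral_def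
    by (simp_all add: integral_lebesgue_Cn_2)
qed

lemma integrable_indicator_hartogs:
  assumes "a > 0"
  shows "integrable (lborel \<Otimes>\<^sub>M lborel) (indicator (hartogs a) :: _ \<Rightarrow> real)"
proof -
  have "bounded (hartogs a)"
    unfolding bounded_iff using norm_hartogs_le[OF _ assms] by blast
  then show ?thesis
    unfolding lborel_prod using open_hartogs[OF assms] emeasure_bounded_finite
    by (intro integrable_real_indicator) auto
qed

lemma holomorphic_hartogs_iff:
  "a > 0 \<Longrightarrow> holomorphic_Cn 2 (hartogs_Cn a) f \<longleftrightarrow> (\<forall>p\<in>hartogs a. cdiff2 (\<lambda>q. f (E2 q)) p)"
  unfolding hartogs_Cn_def by (rule holomorphic_Cn_E2[OF open_hartogs])

lemma holomorphic_hartogs_continuous: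
  assumes "a > 0" "holomorphic_Cn 2 (hartogs_Cn a) f"
  shows "continuous_on (hartogs a) (\<lambda>p. f (E2 p))"
proof (intro continuous_at_imp_continuous_on ballI)
  fix p assume "p \<in> hartogs a"
  then have "cdiff2 (\<lambda>p. f (E2 p)) p" using assms holomorphic_hartogs_iff by blast
  then show "isCont (\<lambda>p. f (E2 p)) p" using cdiff2_slices(3)[of "\<lambda>p. f (E2 p)" "fst p" "snd p"] by simp
qed

text \<open>The domain has finite volume and t \<le> 1 + t^2, so 1 + |f|^2 is an integrable
  majorant.\<close>

lemma bergman_set_integrable:
  assumes a: "a > 0" and f: "f \<in> bergman_space 2 (hartogs_Cn a)"
  shows "set_integrable (lebesgue_Cn 2) (hartogs_Cn a) f"
proof -
  have hol: "holomorphic_Cn 2 (hartogs_Cn a) f"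
    and sq: "integrable (lborel \<Otimes>\<^sub>M lborel) (\<lambda>p. indicator (hartogs a) p *\<^sub>R (cmod (f (E2 p)))\<^sup>2)"
    using f by (simp_all add: bergman_space_def set_integral_hartogs_Cn(1))
  show ?thesis
    unfolding set_integral_hartogs_Cn(1)
  proof (rule Bochner_Integration.integrable_bound)
    show "integrable (lborel \<Otimes>\<^sub>M lborel)
        (\<lambda>p. indicator (hartogs a) p + indicator (hartogs a) p *\<^sub>R (cmod (f (E2 p)))\<^sup>2)"
      by (intro Bochner_Integration.integrable_add integrable_indicator_hartogs a sq)
    show "(\<lambda>p. indicator (hartogs a) p *\<^sub>R f (E2 p)) \<in> borel_measurable (lborel \<Otimes>\<^sub>M lborel)"
      using borel_measurable_continuous_on_indicator[OF _ holomorphic_hartogs_continuous[OF a hol]] open_hartogs[OF a]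
      by (simp add: lborel_prod)
    have "norm (indicator (hartogs a) p *\<^sub>R f (E2 p))
       \<le> norm (indicator (hartogs a) p + indicator (hartogs a) p *\<^sub>R (cmod (f (E2 p)))\<^sup>2)" for p
    proof -
      have "t \<le> 1 + t\<^sup>2" for t :: real
        using zero_le_power2[of "t - 1/2"] by (simp add: power2_eq_square algebra_simps)
      from this[of "cmod (f (E2 p))"] show ?thesis by (simp add: indicator_def)
    qed
    then show "AE p in lborel \<Otimes>\<^sub>M lborel. norm (indicator (hartogs a) p *\<^sub>R f (E2 p))
       \<le> norm (indicator (hartogs a) p + indicator (hartogs a) p *\<^sub>R (cmod (f (E2 p)))\<^sup>2)" by simp
  qed
qed

lemma one_minus_notin_nonpos_Reals: "cmod s < 1 \<Longrightarrow> 1 - s \<notin> \<real>\<^sub>\<le>\<^sub>0"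
  using complex_Re_le_cmod[of s] by (auto simp: complex_nonpos_Reals_iff)

text \<open>Since |s| < 1, the base 1 - s avoids the branch cut, and |u| < 1 avoids the pole of the
  closed form at u = 1.\<close>

lemma hartogs_kernel_holomorphic:
  assumes a: "a > 0" and p: "(z, w) \<in> hartogs a" "(x, y) \<in> hartogs a"
  shows "cdiff2 (\<lambda>q. hartogs_kernel a (fst q * cnj x) (snd q * cnj y)) (z, w)"
proof -
  define s u where "s q = fst q * cnj x" and "u q = snd q * cnj y * (1 - s q) powr of_real (- a)" for q
  define H where "H v = (of_real a * (1 + v) / (1 - v) ^ 3 + 1 / (1 - v) ^ 2) / of_real (pi\<^sup>2)" for v :: complex
  note n = hartogs_parameters[OF a p]
  have s: "cdiff2 s (z, w)" unfolding s_def by (rule cdiff2_fst)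
  have pw: "(\<lambda>v. (1 - v) powr of_real c) field_differentiable at (s (z, w))" for c
    using one_minus_notin_nonpos_Reals[OF n(1)]
    by (auto simp: s_def field_differentiable_def intro!: exI derivative_eq_intros)
  have u: "cdiff2 u (z, w)"
    unfolding u_def by (intro cdiff2_mult[OF cdiff2_snd] cdiff2_compose[OF s] pw)
  have "1 - u (z, w) \<noteq> 0" using n(2) by (auto simp: u_def s_def)
  then have "H field_differentiable at (u (z, w))"
    unfolding H_def by (intro derivative_intros) auto
  then have "cdiff2 (\<lambda>q. (1 - s q) powr of_real (- (a + 2)) * H (u q)) (z, w)"
    by (intro cdiff2_mult cdiff2_compose[OF s] cdiff2_compose[OF u] pw)
  then show ?thesis by (simp add: hartogs_kernel_def Let_def H_def u_def s_def)
qed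

lemma cnj_hartogs_kernel:
  assumes "cmod s < 1"
  shows "cnj (hartogs_kernel a s t) = hartogs_kernel a (cnj s) (cnj t)"
proof -
  have "cnj ((1 - s) powr of_real c) = (1 - cnj s) powr of_real c" for c
    using one_minus_notin_nonpos_Reals[OF assms]
    by (subst cnj_powr) (auto simp: complex_nonpos_Reals_iff)
  from this[of "- (a + 2)"] this[of "- a"] show ?thesis
    by (simp add: hartogs_kernel_def Let_def)
qed

text \<open>Hermitian symmetry converts holomorphy in the first argument into antiholomorphy in the
  second.\<close>

lemma cnj_hartogs_Cn_kernel:
  assumes "a > 0" "p \<in> hartogs a" "q \<in> hartogs a"
  shows "cnj (hartogs_Cn_kernel a (E2 p) (E2 q)) = hartogs_Cn_kernel a (E2 q) (E2 p)"
  using hartogs_parameters(1)[of a "fst p" "snd p" "fst q" "snd q"] assms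
  by (simp add: hartogs_Cn_kernel_def cnj_hartogs_kernel mult.commute)

lemma hartogs_kernel_cdiff2:
  assumes a: "a > 0" and q: "q \<in> hartogs a"
  shows "\<forall>p\<in>hartogs a. cdiff2 (\<lambda>p. hartogs_Cn_kernel a (E2 p) (E2 q)) p"
  using hartogs_kernel_holomorphic[OF a, of _ _ "fst q" "snd q"] q
  by (auto simp: hartogs_Cn_kernel_def)

lemma cdiff2_cong:
  assumes "open U" "p \<in> U" "\<And>q. q \<in> U \<Longrightarrow> F q = G q" "cdiff2 F p"
  shows "cdiff2 G p"
proof -
  obtain a b where "(F has_derivative (\<lambda>h. a * fst h + b * snd h)) (at p)"
    using assms unfolding cdiff2_def by blast
  then have "(G has_derivative (\<lambda>h. a * fst h + b * snd h)) (at p)"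
    by (rule has_derivative_transform_within_open[OF _ assms(1-3)])
  then show ?thesis unfolding cdiff2_def by blast
qed

lemma is_bergman_kernel_hartogs:
  assumes a: "a > 0"
  shows "is_bergman_kernel 2 (hartogs_Cn a) (hartogs_Cn_kernel a)"
  unfolding is_bergman_kernel_def
proof (intro conjI ballI)
  fix w assume "w \<in> hartogs_Cn a"
  then obtain q where w: "w = E2 q" and q: "q \<in> hartogs a" unfolding hartogs_Cn_def by blast
  show "holomorphic_Cn 2 (hartogs_Cn a) (\<lambda>z. hartogs_Cn_kernel a z w)"
    unfolding holomorphic_hartogs_iff[OF a] w by (rule hartogs_kernel_cdiff2[OF a q])
next
  fix z assume "z \<in> hartogs_Cn a"
  then obtain p where z: "z = E2 p" and p: "p \<in> hartogs a" unfolding hartogs_Cn_def by blast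
  let ?g = "\<lambda>w. cnj (hartogs_Cn_kernel a z w)"
  have hol: "holomorphic_Cn 2 (hartogs_Cn a) ?g"
    unfolding holomorphic_hartogs_iff[OF a]
  proof
    fix q assume q: "q \<in> hartogs a"
    show "cdiff2 (\<lambda>q. ?g (E2 q)) q"
      by (rule cdiff2_cong[OF open_hartogs[OF a] q _ bspec[OF hartogs_kernel_cdiff2[OF a p] q]])
         (simp add: z cnj_hartogs_Cn_kernel a p)
  qed
  obtain M where M: "\<And>k. 0 \<le> M k" "summable M"
    "\<And>k x y. (x, y) \<in> hartogs a \<Longrightarrow> cmod (kernel_term a (fst p * cnj x) (snd p * cnj y) k) \<le> M k"
    using hartogs_kernel_majorant[OF a, of "fst p" "snd p"] p by (metis prod.collapse)
  \<comment> \<open>Boundedness in the second argument, together with finite volume, gives square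
    integrability.\<close>
  have bound: "cmod (?g (E2 q)) \<le> suminf M" if q: "q \<in> hartogs a" for q
  proof -
    have pq: "(fst p, snd p) \<in> hartogs a" "(fst q, snd q) \<in> hartogs a" using p q by auto
    have "cmod (?g (E2 q)) = cmod (suminf (kernel_term a (fst p * cnj (fst q)) (snd p * cnj (snd q))))"
      using sums_unique[OF hartogs_kernel_sums[OF a pq]] by (simp add: z hartogs_Cn_kernel_def)
    also have "\<dots> \<le> suminf M"
      by (rule norm_suminf_le[OF M(3)[OF pq(2)] M(2)])
    finally show ?thesis .
  qed
  have "set_integrable (lebesgue_Cn 2) (hartogs_Cn a) (\<lambda>w. (cmod (?g w))\<^sup>2)"
    unfolding set_integral_hartogs_Cn(1)
  proof (rule Bochner_Integration.integrable_bound[OF integrable_mult_right[OF integrable_indicator_hartogs[OF a]], of _ "(suminf M)\<^sup>2"])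
    show "(\<lambda>q. indicator (hartogs a) q *\<^sub>R (cmod (?g (E2 q)))\<^sup>2) \<in> borel_measurable (lborel \<Otimes>\<^sub>M lborel)"
      using borel_measurable_continuous_on_indicator[OF _ continuous_on_power[OF continuous_on_norm[OF
          holomorphic_hartogs_continuous[OF a hol]]]] open_hartogs[OF a]
      by (simp add: lborel_prod del: complex_mod_cnj)
    have "norm (indicator (hartogs a) q *\<^sub>R (cmod (?g (E2 q)))\<^sup>2) \<le> norm ((suminf M)\<^sup>2 * indicator (hartogs a) q)" for q
    proof (cases "q \<in> hartogs a")
      case True
      then have "(cmod (?g (E2 q)))\<^sup>2 \<le> (suminf M)\<^sup>2" using bound by (intro power_mono) auto
      then show ?thesis using True by (simp del: complex_mod_cnj)
    qed simp
    then show "AE q in lborel \<Otimes>\<^sub>M lborel. norm (indicator (hartogs a) q *\<^sub>R (cmod (?g (E2 q)))\<^sup>2) \<le> norm ((suminf M)\<^sup>2 * indicator (hartogs a) q)"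
      by simp
  qed
  with hol show "?g \<in> bergman_space 2 (hartogs_Cn a)" by (simp add: bergman_space_def)
next
  fix f z assume f: "f \<in> bergman_space 2 (hartogs_Cn a)" and "z \<in> hartogs_Cn a"
  then obtain p where z: "z = E2 p" and p: "p \<in> hartogs a" unfolding hartogs_Cn_def by blast
  have pp: "(fst p, snd p) \<in> hartogs a" using p by simp
  have hol: "holomorphic_Cn 2 (hartogs_Cn a) f" using f by (simp add: bergman_space_def)
  then have cd: "cdiff2 (\<lambda>q. f (E2 q)) q" if "q \<in> hartogs a" for q
    using that by (simp add: holomorphic_hartogs_iff[OF a])
  have int: "integrable (lborel \<Otimes>\<^sub>M lborel) (\<lambda>q. indicator (hartogs a) q *\<^sub>R f (E2 (fst q, snd q)))"
    using bergman_set_integrable[OF a f] by (simp add: set_integral_hartogs_Cn(1))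
  have cont: "continuous_on (hartogs a) (\<lambda>(x, y). f (E2 (x, y)))"
    using holomorphic_hartogs_continuous[OF a hol] by (simp add: case_prod_beta')
  have h1: "(\<lambda>x. f (E2 (x, y))) holomorphic_on {x. (x, y) \<in> hartogs a}" for y
    unfolding holomorphic_on_def
  proof
    fix x assume "x \<in> {x. (x, y) \<in> hartogs a}"
    then have "cdiff2 (\<lambda>q. f (E2 q)) (x, y)" by (intro cd) simp
    then show "(\<lambda>x. f (E2 (x, y))) field_differentiable at x within {x. (x, y) \<in> hartogs a}"
      by (rule field_differentiable_at_within[OF cdiff2_slices(1)])
  qed
  have h2: "(\<lambda>y. f (E2 (x, y))) holomorphic_on {y. (x, y) \<in> hartogs a}" for x
    unfolding holomorphic_on_def
  proof
    fix y assume "y \<in> {y. (x, y) \<in> hartogs a}"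
    then have "cdiff2 (\<lambda>q. f (E2 q)) (x, y)" by (intro cd) simp
    then show "(\<lambda>y. f (E2 (x, y))) field_differentiable at y within {y. (x, y) \<in> hartogs a}"
      by (rule field_differentiable_at_within[OF cdiff2_slices(2)])
  qed
  have rep: "(\<integral>q. indicator (hartogs a) q *\<^sub>R (f (E2 q) * hartogs_Cn_kernel a z (E2 q)) \<partial>(lborel \<Otimes>\<^sub>M lborel)) = f z"
    using hartogs_reproducing[OF a pp cont h1 h2 int] by (simp add: z hartogs_Cn_kernel_def)
  show "(LINT w:hartogs_Cn a|lebesgue_Cn 2. f w * hartogs_Cn_kernel a z w) = f z"
  \<comment> \<open>The transfer of integrals asks for integrability of the product; if that failed,
    both integrals would have the default value 0 and would still agree.\<close>
  proof (cases "set_integrable (lebesgue_Cn 2) (hartogs_Cn a) (\<lambda>w. f w * hartogs_Cn_kernel a z w)")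
    case True
    from set_integral_hartogs_Cn(2)[OF this] rep show ?thesis by simp
  next
    case False
    then have "\<not> integrable (lborel \<Otimes>\<^sub>M lborel) (\<lambda>q. indicator (hartogs a) q *\<^sub>R (f (E2 q) * hartogs_Cn_kernel a z (E2 q)))"
      by (simp add: set_integral_hartogs_Cn(1))
    from not_integrable_integral_eq[OF this] rep have "f z = 0" by simp
    moreover have "(LINT w:hartogs_Cn a|lebesgue_Cn 2. f w * hartogs_Cn_kernel a z w) = 0"
      using False unfolding set_integrable_def set_lebesgue_integral_def by (rule not_integrable_integral_eq)
    ultimately show ?thesis by simp
  qed
qed

lemma quadrature_domain_hartogs:
  assumes a: "a > 0"
  shows "quadrature_domain 2 (hartogs_Cn a)"
proof -
  define O2 where "O2 = E2 (0, 0)"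
  define A where "A = {\<lambda>i\<in>{..<2::nat}. 0::nat}"
  \<comment> \<open>This is \<open>kernel_coeff a 0\<close>, the kernel at s = t = 0; its
    reciprocal, the weight of the quadrature formula, is the volume of the domain.\<close>
  define C where "C = complex_of_real ((a + 1) / pi\<^sup>2)"
  have C: "C \<noteq> 0" unfolding C_def of_real_eq_0_iff using a by simp
  have O2: "O2 \<in> hartogs_Cn a" by (simp add: O2_def hartogs_Cn_def hartogs_def)
  have K: "hartogs_Cn_kernel a O2 w = C" for w
    by (simp add: hartogs_Cn_kernel_def O2_def hartogs_kernel_def C_def Let_def)
  have md: "multi_deriv 2 (\<lambda>i\<in>{..<2}. 0) f = f" for f
    by (simp add: numeral_2_eq_2)
  have "(LINT z:hartogs_Cn a|lebesgue_Cn 2. f z) = (\<Sum>z\<in>{O2}. \<Sum>\<alpha>\<in>A. (1 / C) * multi_deriv 2 \<alpha> f z)"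
    if f: "f \<in> bergman_space 2 (hartogs_Cn a)" for f
  proof -
    have "(LINT z:hartogs_Cn a|lebesgue_Cn 2. f z * hartogs_Cn_kernel a O2 z) = f O2"
      using is_bergman_kernel_hartogs[OF a] f O2 by (simp add: is_bergman_kernel_def)
    then have "(LINT z:hartogs_Cn a|lebesgue_Cn 2. f z) * C = f O2"
      unfolding K by simp
    then show ?thesis using C by (simp add: A_def md field_simps)
  qed
  moreover have "finite A" "A \<subseteq> {..<2} \<rightarrow>\<^sub>E UNIV" by (auto simp: A_def)
  ultimately show ?thesis
    unfolding quadrature_domain_def using domain_hartogs[OF a] bergman_set_integrable[OF a] O2
    by (intro conjI exI[of _ "{O2}"] exI[of _ A] exI[of _ "\<lambda>_ _. 1 / C"]) auto
qed

section \<open>Absence of algebraic relations\<close>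

text \<open>\<xi> and \<eta> stand for the conjugated coordinates of the second point, treated as
  free complex variables, and \<kappa> for the kernel value.\<close>

definition eval5 ::
    "complex_mpoly \<Rightarrow> complex \<Rightarrow> complex \<Rightarrow> complex \<Rightarrow> complex \<Rightarrow> complex \<Rightarrow> complex" where
  "eval5 P x y \<xi> \<eta> \<kappa> = (\<Sum>m\<in>Poly_Mapping.keys P. Poly_Mapping.lookup P m *
     (x ^ Poly_Mapping.lookup m 0 * y ^ Poly_Mapping.lookup m 1 * \<xi> ^ Poly_Mapping.lookup m 2 *
      \<eta> ^ Poly_Mapping.lookup m 3 * \<kappa> ^ Poly_Mapping.lookup m 4))"

lemma eval_mpoly_eval5:
  assumes "in_variables 5 P"
  shows "eval_mpoly P v = eval5 P (v 0) (v 1) (v 2) (v 3) (v 4)"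
  unfolding eval_mpoly_def eval5_def
proof (intro sum.cong refl arg_cong2[where f = "(*)"])
  fix m assume "m \<in> Poly_Mapping.keys P"
  then have "Poly_Mapping.keys m \<subseteq> {..<5}" using assms by (auto simp: in_variables_def)
  then have "(\<Prod>i\<in>Poly_Mapping.keys m. v i ^ Poly_Mapping.lookup m i) = (\<Prod>i\<in>{..<5}. v i ^ Poly_Mapping.lookup m i)"
    by (intro prod.mono_neutral_left) (auto simp: in_keys_iff)
  also have "{..<5} = {0, 1, 2, 3, 4 :: nat}" by auto
  finally show "(\<Prod>i\<in>Poly_Mapping.keys m. v i ^ Poly_Mapping.lookup m i) =
     v 0 ^ Poly_Mapping.lookup m 0 * v 1 ^ Poly_Mapping.lookup m 1 * v 2 ^ Poly_Mapping.lookup m 2 *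
     v 3 ^ Poly_Mapping.lookup m 3 * v 4 ^ Poly_Mapping.lookup m 4"
    by (simp add: mult.assoc)
qed

lemma holomorphic_eval5:
  assumes "X holomorphic_on S" "Y holomorphic_on S" "K holomorphic_on S"
  shows "(\<lambda>x. eval5 P (X x) y (Y x) \<eta> (K x)) holomorphic_on S"
  unfolding eval5_def by (intro holomorphic_intros assms)

text \<open>For Re s < 1/2 the point 1 - s lies off the branch cut and |1 - s| is at least 1/2; the
  bound on t then keeps |u| < 1, away from the pole.\<close>

lemma hartogs_kernel_holomorphic_left:
  assumes a: "a > 0" and t: "cmod t < (1 / 2) powr a"
  shows "(\<lambda>s. hartogs_kernel a s t) holomorphic_on {s. Re s < 1 / 2}"
proof -
  have n: "1 - s \<notin> \<real>\<^sub>\<le>\<^sub>0" if "Re s < 1 / 2" for s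
    using that by (auto simp: complex_nonpos_Reals_iff)
  have u: "1 - t * (1 - s) powr of_real (- a) \<noteq> 0" if s: "Re s < 1 / 2" for s
  proof -
    have "1 / 2 \<le> cmod (1 - s)" using s complex_Re_le_cmod[of "1 - s"] by simp
    then have "cmod (1 - s) powr (- a) \<le> (1 / 2) powr (- a)" using a by (intro powr_mono2') auto
    then have "cmod t * cmod (1 - s) powr (- a) \<le> cmod t * (1 / 2) powr (- a)"
      by (intro mult_left_mono) auto
    also have "\<dots> < (1 / 2) powr a * (1 / 2) powr (- a)"
      using t by (intro mult_strict_right_mono) auto
    also have "\<dots> = 1" by (simp add: powr_add[symmetric])
    finally have "cmod (t * (1 - s) powr of_real (- a)) < 1" by (simp add: norm_mult norm_powr_real_powr')
    then show ?thesis by auto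
  qed
  have p: "(\<lambda>s. (1 - s) powr of_real c) holomorphic_on {s. Re s < 1 / 2}" for c
    by (intro holomorphic_intros) (use n in auto)
  show ?thesis
    unfolding hartogs_kernel_def Let_def
    by (intro holomorphic_intros p) (use u in auto)
qed

lemma Re_affine_half_plane:
  "convex {x. Re (c * x) < b}" "open {x. Re (c * x) < b}"
proof -
  have "{x. Re (c * x) < b} = {x. inner (cnj c) x < b}"
    by (simp add: inner_complex_def)
  then show "convex {x. Re (c * x) < b}" "open {x. Re (c * x) < b}"
    by (simp_all add: convex_halfspace_lt open_halfspace_lt)
qed

text \<open>
  The curve used for the asymptotics leaves the domain: the kernel is holomorphic
  in \<open>x \<xi>\<close> on a half-plane containing the negative axis, and there the powers of \<open>x\<close> and
  \<open>\<xi>\<close> grow, whereas they all tend to \<open>1\<close> at the boundary point \<open>x = \<xi> = 1\<close>.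
\<close>
lemma eval5_continuation:
  assumes a: "a > 0" and t: "cmod (y * \<eta>) < (1 / 2) powr a" and R: "R > 0" and X: "X > 0"
    and zero: "\<And>x \<xi>. cmod x < 1 / 2 \<Longrightarrow> cmod \<xi> < 1 / 2 \<Longrightarrow>
      eval5 P x y \<xi> \<eta> (hartogs_kernel a (x * \<xi>) (y * \<eta>)) = 0"
  shows "eval5 P (- of_real R) y (of_real X) \<eta> (hartogs_kernel a (- of_real R * of_real X) (y * \<eta>)) = 0"
proof -
  note hol = holomorphic_on_compose_gen[OF _ hartogs_kernel_holomorphic_left[OF a t], unfolded o_def]
  \<comment> \<open>The identity theorem is used one variable at a time: x is moved to - R while
    \<xi> is small, then \<xi> is moved to X. With one variable fixed, Re (x \<xi>) < 1/2 is convex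
    in the other, hence connected.\<close>
  have left: "eval5 P (- of_real R) y \<xi> \<eta> (hartogs_kernel a (- of_real R * \<xi>) (y * \<eta>)) = 0"
    if \<xi>: "cmod \<xi> < 1 / 2" "Re (- of_real R * \<xi>) < 1 / 2" for \<xi>
  proof (rule analytic_continuation_open[of "ball 0 (1/2)" "{x. Re (\<xi> * x) < 1 / 2}"
        "\<lambda>x. eval5 P x y \<xi> \<eta> (hartogs_kernel a (x * \<xi>) (y * \<eta>))" "\<lambda>_. 0"])
    show "ball 0 (1 / 2) \<subseteq> {x. Re (\<xi> * x) < 1 / 2}"
    proof safe
      fix x :: complex assume "x \<in> ball 0 (1 / 2)"
      moreover have "cmod \<xi> * cmod x \<le> 1 / 2 * cmod x"
        using \<xi> by (intro mult_right_mono) auto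
      ultimately have "cmod \<xi> * cmod x < 1 / 2" by simp
      then show "Re (\<xi> * x) < 1 / 2" using complex_Re_le_cmod[of "\<xi> * x"] by (simp add: norm_mult)
    qed
    show "(\<lambda>x. eval5 P x y \<xi> \<eta> (hartogs_kernel a (x * \<xi>) (y * \<eta>))) holomorphic_on {x. Re (\<xi> * x) < 1 / 2}"
      by (intro holomorphic_eval5 hol holomorphic_intros) (auto simp: mult.commute)
    show "open {x. Re (\<xi> * x) < 1 / 2}" "connected {x. Re (\<xi> * x) < 1 / 2}"
      by (intro convex_connected Re_affine_half_plane)+
    show "- complex_of_real R \<in> {x. Re (\<xi> * x) < 1 / 2}"
      using \<xi>(2) by (simp add: mult.commute)
  qed (use \<xi> zero in auto)
  show ?thesis
  \<comment> \<open>The vanishing is known only where both conditions of \<open>left\<close> hold;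
    their intersection is open and contains 0.\<close>
  proof (rule analytic_continuation_open[of "ball 0 (1/2) \<inter> {\<xi>. Re (- of_real R * \<xi>) < 1 / 2}" "{\<xi>. Re (- of_real R * \<xi>) < 1 / 2}"
        "\<lambda>\<xi>. eval5 P (- of_real R) y \<xi> \<eta> (hartogs_kernel a (- of_real R * \<xi>) (y * \<eta>))" "\<lambda>_. 0"])
    show "open (ball 0 (1 / 2) \<inter> {\<xi>. Re (- complex_of_real R * \<xi>) < 1 / 2})"
      "open {\<xi>. Re (- complex_of_real R * \<xi>) < 1 / 2}"
      by (intro open_Int open_ball Re_affine_half_plane)+
    show "connected {\<xi>. Re (- complex_of_real R * \<xi>) < 1 / 2}"
      by (intro convex_connected Re_affine_half_plane)
    show "ball 0 (1 / 2) \<inter> {\<xi>. Re (- complex_of_real R * \<xi>) < 1 / 2} \<noteq> {}"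
    proof -
      have "0 \<in> ball 0 (1 / 2) \<inter> {\<xi>. Re (- complex_of_real R * \<xi>) < 1 / 2}" by simp
      then show ?thesis by blast
    qed
    show "(\<lambda>\<xi>. eval5 P (- of_real R) y \<xi> \<eta> (hartogs_kernel a (- of_real R * \<xi>) (y * \<eta>)))
        holomorphic_on {\<xi>. Re (- complex_of_real R * \<xi>) < 1 / 2}"
      by (intro holomorphic_eval5 hol holomorphic_intros) auto
    show "complex_of_real X \<in> {\<xi>. Re (- complex_of_real R * \<xi>) < 1 / 2}"
    proof -
      have "R * X > 0" using R X by simp
      then show ?thesis by simp
    qed
  qed (use left in auto)
qed

text \<open>
  \<open>e B m\<close> is the growth exponent of the monomial \<open>m\<close> along the curve \<open>x = - \<rho>\<close>,
  \<open>\<xi> = \<rho> powr B\<close>, \<open>y = \<rho> powr (- B\<^sup>2)\<close>, \<open>\<eta> = \<rho> powr (- B\<^sup>3)\<close>, on which the kernel is of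
  order \<open>\<rho> powr (- (2 + a) (1 + B))\<close>.
\<close>
lemma ex_generic_exponents:
  fixes a :: real and S :: "(nat \<Rightarrow>\<^sub>0 nat) set"
  assumes a: "a \<notin> \<rat>" and S: "finite S" "\<And>m. m \<in> S \<Longrightarrow> Poly_Mapping.keys m \<subseteq> {..<5}"
  defines "e \<equiv> \<lambda>B m. real (Poly_Mapping.lookup m 0) - B\<^sup>2 * real (Poly_Mapping.lookup m 1)
    + B * real (Poly_Mapping.lookup m 2) - B ^ 3 * real (Poly_Mapping.lookup m 3)
    - (2 + a) * (1 + B) * real (Poly_Mapping.lookup m 4)"
  shows "\<exists>B>0. inj_on (e B) S"
proof -
  \<comment> \<open>The exponent read as a cubic in B. Its coefficients of B^2 and B^3 give the
    exponents of y and \<eta>; the other two mix those of x and \<xi> with that of the kernel, and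
    irrationality of \<open>a\<close> separates them by \<open>irr\<close>. Distinct monomials thus
    have distinct cubics.\<close>
  define p where "p m = [: real (Poly_Mapping.lookup m 0) - (2 + a) * real (Poly_Mapping.lookup m 4),
     real (Poly_Mapping.lookup m 2) - (2 + a) * real (Poly_Mapping.lookup m 4),
     - real (Poly_Mapping.lookup m 1), - real (Poly_Mapping.lookup m 3) :]" for m :: "nat \<Rightarrow>\<^sub>0 nat"
  have ep: "e B m = poly (p m) B" for B m
    by (simp add: e_def p_def algebra_simps power2_eq_square power3_eq_cube)
  have irr: "j = j' \<and> i = i'"
    if "real i - (2 + a) * real j = real i' - (2 + a) * real j'" for i i' j j' :: nat
  proof -
    have "j = j'"
    proof (rule ccontr)
      assume "j \<noteq> j'"
      then have "a = (real i - real i') / (real j - real j') - 2"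
        using that by (simp add: field_simps)
      also have "\<dots> \<in> \<rat>" by (intro Rats_diff Rats_divide) auto
      finally show False using a by simp
    qed
    then show ?thesis using that by simp
  qed
  have inj: "m = m'" if m: "m \<in> S" "m' \<in> S" and eq: "p m = p m'" for m m'
  proof (rule poly_mapping_eqI)
    fix i
    have *: "Poly_Mapping.lookup m 0 = Poly_Mapping.lookup m' 0" "Poly_Mapping.lookup m 1 = Poly_Mapping.lookup m' 1"
      "Poly_Mapping.lookup m 2 = Poly_Mapping.lookup m' 2" "Poly_Mapping.lookup m 3 = Poly_Mapping.lookup m' 3"
      "Poly_Mapping.lookup m 4 = Poly_Mapping.lookup m' 4"
      using eq irr by (auto simp: p_def)
    show "Poly_Mapping.lookup m i = Poly_Mapping.lookup m' i"
    proof (cases "i < 5")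
      case True
      then consider "i = 0" | "i = 1" | "i = 2" | "i = 3" | "i = 4" by linarith
      then show ?thesis using * by cases auto
    next
      case False
      then have "i \<notin> Poly_Mapping.keys m" "i \<notin> Poly_Mapping.keys m'" using S(2) m by auto
      then show ?thesis by (simp add: in_keys_iff)
    qed
  qed
  \<comment> \<open>Values of B at which two distinct cubics meet; finitely many pairs with finitely
    many roots each leave a positive B.\<close>
  define bad where "bad = (\<Union>mm\<in>{mm\<in>S \<times> S. fst mm \<noteq> snd mm}. {B. poly (p (fst mm) - p (snd mm)) B = 0})"
  have "finite bad"
    unfolding bad_def
  proof (rule finite_UN_I)
    show "finite {mm \<in> S \<times> S. fst mm \<noteq> snd mm}" using S(1) by simp
    fix mm assume "mm \<in> {mm \<in> S \<times> S. fst mm \<noteq> snd mm}"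
    then have "p (fst mm) - p (snd mm) \<noteq> 0" using inj[of "fst mm" "snd mm"] by auto
    then show "finite {B. poly (p (fst mm) - p (snd mm)) B = 0}" by (rule poly_roots_finite)
  qed
  then have "infinite ({0<..} - bad)"
    by (intro Diff_infinite_finite infinite_Ioi)
  then obtain B where B: "B > 0" "B \<notin> bad" using infinite_imp_nonempty by blast
  have "inj_on (e B) S"
  proof (rule inj_onI, rule ccontr)
    fix m m' assume "m \<in> S" "m' \<in> S" "e B m = e B m'" "m \<noteq> m'"
    then have "B \<in> bad" unfolding bad_def ep by force
    with B show False by simp
  qed
  with B show ?thesis by blast
qed

text \<open>On the curve 1 - s is the positive real q = 1 + \<rho> powr (1 + B), so all powers are
  real. Both t and q powr (- a) tend to 0, hence u does; the growth comes from q powr (- a - 2) and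
  the constant is the remaining factor at u = 0.\<close>

lemma hartogs_kernel_asymptotics:
  fixes a B :: real
  assumes a: "a > 0" and B: "B > 0"
  defines "k \<equiv> \<lambda>\<rho>. hartogs_kernel a (- of_real \<rho> * of_real (\<rho> powr B))
    (of_real (\<rho> powr (- B\<^sup>2)) * of_real (\<rho> powr (- (B ^ 3))))"
  shows "((\<lambda>\<rho>. k \<rho> * of_real (\<rho> powr ((2 + a) * (1 + B)))) \<longlongrightarrow> of_real ((a + 1) / pi\<^sup>2)) at_top"
proof -
  define q where "q \<rho> = 1 + \<rho> powr (1 + B)" for \<rho> :: real
  define u where "u \<rho> = \<rho> powr (- (B\<^sup>2 + B ^ 3)) * q \<rho> powr (- a)" for \<rho> :: real
  define h where "h \<rho> = (q \<rho> / \<rho> powr (1 + B)) powr (- (a + 2)) * ((a * (1 + u \<rho>) / (1 - u \<rho>) ^ 3 + 1 / (1 - u \<rho>) ^ 2) / pi\<^sup>2)" for \<rho>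
  have k: "k \<rho> * of_real (\<rho> powr ((2 + a) * (1 + B))) = of_real (h \<rho>)" if \<rho>: "\<rho> > 0" for \<rho>
  proof -
    have q: "q \<rho> > 0" by (simp add: q_def add_pos_nonneg)
    have s: "1 - - complex_of_real \<rho> * of_real (\<rho> powr B) = of_real (q \<rho>)"
      using \<rho> by (simp add: q_def powr_add)
    have pw: "complex_of_real (q \<rho>) powr of_real c = of_real (q \<rho> powr c)" for c
      using q by (simp add: powr_of_real)
    have t: "complex_of_real (\<rho> powr (- B\<^sup>2)) * of_real (\<rho> powr (- (B ^ 3))) = of_real (\<rho> powr (- (B\<^sup>2 + B ^ 3)))"
      by (simp add: powr_add[symmetric] flip: of_real_mult)
    have "k \<rho> = of_real (q \<rho> powr (- (a + 2)) * ((a * (1 + u \<rho>) / (1 - u \<rho>) ^ 3 + 1 / (1 - u \<rho>) ^ 2) / pi\<^sup>2))"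
      unfolding k_def hartogs_kernel_def Let_def s t pw u_def by simp
    moreover have "(q \<rho> / \<rho> powr (1 + B)) powr (- (a + 2)) = q \<rho> powr (- (a + 2)) * \<rho> powr ((2 + a) * (1 + B))"
    proof -
      have "(q \<rho> / \<rho> powr (1 + B)) powr (- (a + 2)) = q \<rho> powr (- (a + 2)) / \<rho> powr ((1 + B) * (- (a + 2)))"
        using q \<rho> by (simp only: powr_divide less_imp_le powr_ge_zero powr_powr)
      also have "\<dots> = q \<rho> powr (- (a + 2)) * \<rho> powr (- ((1 + B) * (- (a + 2))))"
        by (simp only: powr_minus divide_inverse)
      also have "- ((1 + B) * (- (a + 2))) = (2 + a) * (1 + B)" by (simp add: algebra_simps)
      finally show ?thesis .
    qed
    ultimately show ?thesis unfolding h_def by simp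
  qed
  have top: "filterlim (\<lambda>\<rho>::real. \<rho> powr (1 + B)) at_top at_top"
    using B by real_asymp
  have z: "((\<lambda>\<rho>::real. \<rho> powr (- c)) \<longlongrightarrow> 0) at_top" if "c > 0" for c
    using that by (intro tendsto_neg_powr filterlim_ident) auto
  have q1: "((\<lambda>\<rho>. q \<rho> / \<rho> powr (1 + B)) \<longlongrightarrow> 1) at_top"
    unfolding q_def using B by real_asymp
  have "filterlim q at_top at_top"
    unfolding q_def by (rule filterlim_tendsto_add_at_top[OF tendsto_const top])
  then have "((\<lambda>\<rho>. q \<rho> powr (- a)) \<longlongrightarrow> 0) at_top"
    using a by (intro tendsto_neg_powr) auto
  then have u: "(u \<longlongrightarrow> 0 * 0) at_top"
    unfolding u_def using B by (intro tendsto_mult z) (auto intro: add_pos_pos)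
  have "(h \<longlongrightarrow> 1 powr (- (a + 2)) * ((a * (1 + 0) / (1 - 0) ^ 3 + 1 / (1 - 0) ^ 2) / pi\<^sup>2)) at_top"
    unfolding h_def using u by (intro tendsto_intros q1) auto
  then have "((\<lambda>\<rho>. complex_of_real (h \<rho>)) \<longlongrightarrow> of_real ((a + 1) / pi\<^sup>2)) at_top"
    by (intro tendsto_of_real) simp
  then show ?thesis
    by (rule Lim_transform_eventually)
       (use eventually_gt_at_top[of 0] in \<open>eventually_elim, simp only: k\<close>)
qed

text \<open>After division by the fastest growing power of \<rho>, a single monomial of P has a
  nonzero limit, which contradicts the vanishing of the sum.\<close>

lemma not_algebraic_hartogs:
  assumes a: "a > 0" "a \<notin> \<rat>"
  shows "\<not> algebraic_kernel 2 (hartogs_Cn a) (hartogs_Cn_kernel a)"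
proof
  assume "algebraic_kernel 2 (hartogs_Cn a) (hartogs_Cn_kernel a)"
  then obtain P where P: "P \<noteq> 0" and var: "in_variables 5 P"
    and van: "\<And>z w. z \<in> hartogs_Cn a \<Longrightarrow> w \<in> hartogs_Cn a \<Longrightarrow>
       eval_mpoly P (\<lambda>i. if i < 2 then z i else if i < 2 * 2 then cnj (w (i - 2)) else hartogs_Cn_kernel a z w) = 0"
    unfolding algebraic_kernel_def by auto
  \<comment> \<open>The second point is taken with coordinates cnj \<xi> and cnj \<eta>, so that its
    conjugates become the free variables.\<close>
  have zero0: "eval5 P x y \<xi> \<eta> (hartogs_kernel a (x * \<xi>) (y * \<eta>)) = 0"
    if "(x, y) \<in> hartogs a" "(cnj \<xi>, cnj \<eta>) \<in> hartogs a" for x y \<xi> \<eta>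
    using van[of "E2 (x, y)" "E2 (cnj \<xi>, cnj \<eta>)"] that
    unfolding eval_mpoly_eval5[OF var] by (simp add: hartogs_Cn_def hartogs_Cn_kernel_def)
  \<comment> \<open>Half of (1/2) powr a \<le> 1, so that r^2 is below (1/2) powr a as well. This
    serves two ends: (x, y) with |x| < 1/2 and |y| < r lies in the domain, and t = y \<eta> meets
    the bound for the continuation.\<close>
  define r where "r = ((1 / 2) powr a) / 2"
  have r: "0 < r" "r\<^sup>2 < (1 / 2) powr a" "r < 1"
  proof -
    have "(1 / 2 :: real) powr a \<le> 1 powr a" using a by (intro powr_mono2) auto
    then have g: "0 < (1 / 2 :: real) powr a" "(1 / 2 :: real) powr a \<le> 1" by auto
    have "g' / 2 * (g' / 2) < g'" if "0 < g'" "g' \<le> 1" for g' :: real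
      using mult_left_mono[of g' 1 g'] that by simp
    from this[OF g] g show "0 < r" "r\<^sup>2 < (1 / 2) powr a" "r < 1"
      by (auto simp: r_def power2_eq_square)
  qed
  have small: "(x, y) \<in> hartogs a" if "cmod x < 1 / 2" "cmod y < r" for x y
  proof -
    have "(cmod x)\<^sup>2 \<le> (1 / 2)\<^sup>2" using that by (intro power_mono) auto
    then have "(1 / 2) powr a \<le> (1 - (cmod x)\<^sup>2) powr a"
      using a by (intro powr_mono2) (auto simp: power2_eq_square)
    moreover have "(cmod y)\<^sup>2 \<le> r\<^sup>2" using that by (intro power_mono) auto
    ultimately have "(cmod y)\<^sup>2 < (1 - (cmod x)\<^sup>2) powr a" using r by linarith
    then show ?thesis using that by (simp add: hartogs_def)
  qed
  have zero: "eval5 P (- of_real R) (of_real y) (of_real X) (of_real \<eta>)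
      (hartogs_kernel a (- of_real R * of_real X) (of_real y * of_real \<eta>)) = 0"
    if "R > 0" "X > 0" "0 < y" "y < r" "0 < \<eta>" "\<eta> < r" for R X y \<eta> :: real
  proof (rule eval5_continuation[OF a(1)])
    have "y * \<eta> \<le> r * r" using that by (intro mult_mono) auto
    then show "cmod (of_real y * of_real \<eta>) < (1 / 2) powr a"
      using that r by (simp add: norm_mult power2_eq_square)
    show "eval5 P x (of_real y) \<xi> (of_real \<eta>) (hartogs_kernel a (x * \<xi>) (of_real y * of_real \<eta>)) = 0"
      if "cmod x < 1 / 2" "cmod \<xi> < 1 / 2" for x \<xi>
      using that \<open>0 < y\<close> \<open>y < r\<close> \<open>0 < \<eta>\<close> \<open>\<eta> < r\<close> by (intro zero0 small) auto
  qed (use that in auto)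
  define e where "e B m = real (Poly_Mapping.lookup m 0) - B\<^sup>2 * real (Poly_Mapping.lookup m 1)
    + B * real (Poly_Mapping.lookup m 2) - B ^ 3 * real (Poly_Mapping.lookup m 3)
    - (2 + a) * (1 + B) * real (Poly_Mapping.lookup m 4)" for B and m :: "nat \<Rightarrow>\<^sub>0 nat"
  obtain B where B: "B > 0" and inj: "inj_on (e B) (Poly_Mapping.keys P)"
    using ex_generic_exponents[OF a(2), of "Poly_Mapping.keys P"] var
    unfolding e_def in_variables_def by auto
  define k where "k \<rho> = hartogs_kernel a (- of_real \<rho> * of_real (\<rho> powr B))
    (of_real (\<rho> powr (- B\<^sup>2)) * of_real (\<rho> powr (- (B ^ 3))))" for \<rho> :: real
  define L where "L = (2 + a) * (1 + B)"
  have klim: "((\<lambda>\<rho>. k \<rho> * of_real (\<rho> powr L)) \<longlongrightarrow> of_real ((a + 1) / pi\<^sup>2)) at_top"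
    unfolding k_def L_def by (rule hartogs_kernel_asymptotics[OF a(1) B])
  have ne: "Poly_Mapping.keys P \<noteq> {}" using P by simp
  define E where "E = Max (e B ` Poly_Mapping.keys P)"
  have "E \<in> e B ` Poly_Mapping.keys P" unfolding E_def using ne by (intro Max_in) auto
  then obtain m0 where m0: "m0 \<in> Poly_Mapping.keys P" "e B m0 = E" by auto
  have less: "e B m < E" if "m \<in> Poly_Mapping.keys P" "m \<noteq> m0" for m
  proof -
    have "e B m \<le> E" unfolding E_def using that by (intro Max_ge) auto
    moreover have "e B m \<noteq> E" using inj_onD[OF inj] that m0 by metis
    ultimately show ?thesis by simp
  qed
  \<comment> \<open>The term of m divided by \<rho> powr E. The sign comes from x = - \<rho>, and
    the kernel is multiplied by \<rho> powr L to have a finite limit, which the summand of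
    \<open>e\<close> with the factor L compensates.\<close>
  define T where "T m \<rho> = Poly_Mapping.lookup P m * (- 1) ^ Poly_Mapping.lookup m 0 *
     of_real (\<rho> powr (e B m - E)) * (k \<rho> * of_real (\<rho> powr L)) ^ Poly_Mapping.lookup m 4" for m \<rho>
  have "\<forall>\<^sub>F \<rho> in at_top. (\<Sum>m\<in>Poly_Mapping.keys P. T m \<rho>) = 0"
  proof -
    \<comment> \<open>Both y and \<eta> tend to 0 along the curve and so eventually fall below r,
      where \<open>zero\<close> applies.\<close>
    have "\<forall>\<^sub>F \<rho>::real in at_top. \<rho> powr (- c) < r" if "c > 0" for c
      using that r(1) by (intro order_tendstoD(2)[OF tendsto_neg_powr[OF _ filterlim_ident]]) auto
    from this[of "B\<^sup>2"] this[of "B ^ 3"] B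
    have "\<forall>\<^sub>F \<rho> in at_top. \<rho> powr (- B\<^sup>2) < r" "\<forall>\<^sub>F \<rho> in at_top. \<rho> powr (- (B ^ 3)) < r"
      by simp_all
    from this eventually_gt_at_top[of 0]
    show ?thesis
    proof eventually_elim
      case (elim \<rho>)
      have \<rho>: "\<rho> > 0" using elim B by simp
      have T: "T m \<rho> = of_real (\<rho> powr (- E)) * (Poly_Mapping.lookup P m *
         ((- of_real \<rho>) ^ Poly_Mapping.lookup m 0 * of_real (\<rho> powr (- B\<^sup>2)) ^ Poly_Mapping.lookup m 1 *
          of_real (\<rho> powr B) ^ Poly_Mapping.lookup m 2 * of_real (\<rho> powr (- (B ^ 3))) ^ Poly_Mapping.lookup m 3 *
          k \<rho> ^ Poly_Mapping.lookup m 4))" for m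
      proof -
        have pp: "(\<rho> powr b) ^ n = \<rho> powr (b * real n)" for b n
          using \<rho> by (simp add: powr_power mult.commute)
        have "\<rho> powr (e B m - E) * (\<rho> powr L) ^ Poly_Mapping.lookup m 4
            = \<rho> powr (e B m - E + L * Poly_Mapping.lookup m 4)"
          using \<rho> by (simp add: powr_power powr_add mult.commute)
        also have "e B m - E + L * Poly_Mapping.lookup m 4 = - E + (real (Poly_Mapping.lookup m 0)
           + (- B\<^sup>2 * real (Poly_Mapping.lookup m 1)) + B * real (Poly_Mapping.lookup m 2)
           + (- (B ^ 3) * real (Poly_Mapping.lookup m 3)))"
          unfolding e_def L_def by (simp add: algebra_simps)
        also have "\<rho> powr \<dots> = \<rho> powr (- E) * (\<rho> ^ Poly_Mapping.lookup m 0 * (\<rho> powr (- B\<^sup>2)) ^ Poly_Mapping.lookup m 1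
           * (\<rho> powr B) ^ Poly_Mapping.lookup m 2 * (\<rho> powr (- (B ^ 3))) ^ Poly_Mapping.lookup m 3)"
          using \<rho> by (simp only: powr_add pp powr_realpow)
        finally have "complex_of_real (\<rho> powr (e B m - E)) * of_real (\<rho> powr L) ^ Poly_Mapping.lookup m 4
          = of_real (\<rho> powr (- E)) * (of_real \<rho> ^ Poly_Mapping.lookup m 0 * of_real (\<rho> powr (- B\<^sup>2)) ^ Poly_Mapping.lookup m 1
           * of_real (\<rho> powr B) ^ Poly_Mapping.lookup m 2 * of_real (\<rho> powr (- (B ^ 3))) ^ Poly_Mapping.lookup m 3)"
          by (simp only: of_real_mult[symmetric] of_real_power[symmetric])
        moreover have "(- complex_of_real \<rho>) ^ n = (- 1) ^ n * of_real \<rho> ^ n" for n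
          by (rule power_minus)
        ultimately show ?thesis
          unfolding T_def power_mult_distrib by (simp only: mult_ac)
      qed
      have "(\<Sum>m\<in>Poly_Mapping.keys P. T m \<rho>) = of_real (\<rho> powr (- E)) *
         eval5 P (- of_real \<rho>) (of_real (\<rho> powr (- B\<^sup>2))) (of_real (\<rho> powr B)) (of_real (\<rho> powr (- (B ^ 3)))) (k \<rho>)"
        unfolding eval5_def sum_distrib_left T ..
      also have "\<dots> = 0"
        using zero[of \<rho> "\<rho> powr B" "\<rho> powr (- B\<^sup>2)" "\<rho> powr (- (B ^ 3))"] elim \<rho> B by (simp add: k_def)
      finally show ?case .
    qed
  qed
  moreover have "((\<lambda>\<rho>. \<Sum>m\<in>Poly_Mapping.keys P. T m \<rho>) \<longlongrightarrow>
      (\<Sum>m\<in>Poly_Mapping.keys P. Poly_Mapping.lookup P m * (- 1) ^ Poly_Mapping.lookup m 0 *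
         of_real (if m = m0 then 1 else 0) * of_real ((a + 1) / pi\<^sup>2) ^ Poly_Mapping.lookup m 4)) at_top"
    unfolding T_def
  proof (intro tendsto_sum tendsto_mult tendsto_const tendsto_power klim tendsto_of_real)
    fix m assume m: "m \<in> Poly_Mapping.keys P"
    show "((\<lambda>\<rho>. \<rho> powr (e B m - E)) \<longlongrightarrow> (if m = m0 then 1 else 0)) at_top"
    proof (cases "m = m0")
      case True
      have "((\<lambda>\<rho>::real. 1) \<longlongrightarrow> 1) at_top" by simp
      then have "((\<lambda>\<rho>. \<rho> powr (e B m - E)) \<longlongrightarrow> 1) at_top"
        by (rule Lim_transform_eventually)
           (use eventually_gt_at_top[of 0] True m0 in \<open>auto elim!: eventually_mono\<close>)
      then show ?thesis using True by simp
    next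
      case False
      then show ?thesis using less[OF m] by (simp add: tendsto_neg_powr filterlim_ident)
    qed
  qed
  ultimately have "(\<Sum>m\<in>Poly_Mapping.keys P. Poly_Mapping.lookup P m * (- 1) ^ Poly_Mapping.lookup m 0 *
         of_real (if m = m0 then 1 else 0) * of_real ((a + 1) / pi\<^sup>2) ^ Poly_Mapping.lookup m 4) = (0::complex)"
    by (intro tendsto_unique[OF trivial_limit_at_top_linorder _ tendsto_eventually])
  also have "(\<Sum>m\<in>Poly_Mapping.keys P. Poly_Mapping.lookup P m * (- 1) ^ Poly_Mapping.lookup m 0 *
         of_real (if m = m0 then 1 else 0) * of_real ((a + 1) / pi\<^sup>2) ^ Poly_Mapping.lookup m 4)
      = (\<Sum>m\<in>{m0}. Poly_Mapping.lookup P m * (- 1) ^ Poly_Mapping.lookup m 0 * of_real ((a + 1) / pi\<^sup>2) ^ Poly_Mapping.lookup m 4)"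
    using m0 by (intro sum.mono_neutral_cong_right) auto
  finally have "Poly_Mapping.lookup P m0 * complex_of_real ((a + 1) / pi\<^sup>2) ^ Poly_Mapping.lookup m0 4 = 0"
    by simp
  \<comment> \<open>A zero limit of the normalised kernel would hide the coefficient of
    \<open>m0\<close> whenever the kernel occurs in that monomial.\<close>
  moreover have "complex_of_real ((a + 1) / pi\<^sup>2) \<noteq> 0" unfolding of_real_eq_0_iff using a by simp
  ultimately have "Poly_Mapping.lookup P m0 = 0" by (simp only: mult_eq_0_iff power_eq_0_iff) simp
  then show False using m0 by (simp add: in_keys_iff)
qed

lemma ex_irrational_pos: "\<exists>a::real. a > 0 \<and> a \<notin> \<rat>"
proof -
  have "uncountable {0<..<1::real}" by (simp add: uncountable_open_interval)
  then have "\<not> {0<..<1::real} \<subseteq> \<rat>" using countable_rat countable_subset by blast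
  then show ?thesis by auto
qed

theorem proposition4p3:
  shows "\<exists>(n::nat) (\<Omega> :: (nat \<Rightarrow> complex) set) K.
           n \<ge> 2 \<and> bounded_Cn n \<Omega> \<and> quadrature_domain n \<Omega> \<and>
           is_bergman_kernel n \<Omega> K \<and> \<not> algebraic_kernel n \<Omega> K"
proof -
  obtain a :: real where a: "a > 0" "a \<notin> \<rat>" using ex_irrational_pos by blast
  then show ?thesis
    using bounded_hartogs quadrature_domain_hartogs is_bergman_kernel_hartogs not_algebraic_hartogs
    by (intro exI[of _ 2] exI[of _ "hartogs_Cn a"] exI[of _ "hartogs_Cn_kernel a"]) auto
qed

end
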